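(* If $\mathcal{V}$ is a variety of ordered algebras, then $\mathcal{V}\simeq\mathcal{P}_{\mathrm{ex}}$, where $\mathcal{P}$ is the full subcategory of $\mathcal{V}$ on the algebras which are free on a discrete poset.
   Context: Conventions. $\mathsf{Pos}$ is the cartesian closed category of posets and monotone maps. "Category" means $\mathsf{Pos}$-enriched category (hom-sets are posets and composition is monotone in both variables); "functor" means locally monotone functor; $\simeq$ denotes equivalence of $\mathsf{Pos}$-enriched categories. Varieties of ordered algebras (in the sense of Bloom and Wright). Given a finitary signature, an ordered algebra is a poset equipped with a monotone operation for each operation symbol; a homomorphism is a monotone map preserving the operations; homs are ordered pointwise. A variety of ordered algebras is the category of all ordered algebras (for a given signature) satisfying a given set of inequations $s\leq t$ between terms, with all homomorphisms. The algebras free on a discrete poset are the values on discrete posets of the left adjoint to the forgetful functor $\mathcal{V}\to\mathsf{Pos}$. Weakly lex categories. For a diagram $D\colon\mathcal{D}\to\mathcal{C}$ and a weight $W\colon\mathcal{D}\to\mathsf{Pos}$, a weak $W$-weighted limit is an object $\{W,D\}_w$ with a natural transformation $W\to\mathcal{C}(\{W,D\}_w,D-)$ such that for all $X$ the induced map $\mathcal{C}(X,\{W,D\}_w)\to[\mathcal{D},\mathsf{Pos}](W,\mathcal{C}(X,D-))$ is surjective. $W$ is finite if $\mathcal{D}$ has finitely many isomorphism classes of objects and all $\mathcal{D}(d,d')$ and $Wd$ are finite. $\mathcal{C}$ is weakly lex if all weak limits with finite weights exist. The category $\mathcal{P}$ is weakly lex. The category $\mathcal{C}_{\mathrm{ex}}$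 for $\mathcal{C}$ weakly lex. A pseudocongruence in $\mathcal{C}$ is a parallel pair $r_0,r_1\colon R\to X$ such that: (1) for every $a_0\leq a_1\colon A\to X$ there is $u\colon A\to R$ with $r_0u=a_0$, $r_1u=a_1$; (2) for a weak pullback $d_0,d_1\colon R*R\to R$ with $r_1d_0=r_0d_1$ there is $\tau\colon R*R\to R$ with $r_0\tau=r_0d_0$, $r_1\tau=r_1d_1$. Objects of $\mathcal{C}_{\mathrm{ex}}$ are the pseudocongruences, written $(X,R)$. Given $(X,R)$ and $(Y,S)$, consider $f\colon X\to Y$ in $\mathcal{C}$ for which there is $\bar f\colon R\to S$ with $s_0\bar f=fr_0$, $s_1\bar f=fr_1$; put $f\preccurlyeq g$ iff there is $\Sigma\colon X\to S$ with $s_0\Sigma=f$, $s_1\Sigma=g$ (a preorder). Morphisms $[f]\colon(X,R)\to(Y,S)$ are the classes of such $f$ under the induced equivalence relation, ordered by $[f]\leq[g]$ iff $f\preccurlyeq g$, with composition induced from $\mathcal{C}$. *)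

theory Defs
  imports Main "HOL-Library.FuncSet" "HOL-Library.Equipollence"
begin

section \<open>Categories enriched in posets\<close>

text \<open>
  Hom-sets are indexed by a pair of objects and need not be disjoint, so composition and the
  hom-orders take the objects as arguments: \<open>cmp C X Y Z g f\<close> is the composite of
  \<open>f \<in> hom C X Y\<close> followed by \<open>g \<in> hom C Y Z\<close>.
\<close>

record ('o, 'a) pcat =
  obj :: "'o set"
  hom :: "'o \<Rightarrow> 'o \<Rightarrow> 'a set"
  hle :: "'o \<Rightarrow> 'o \<Rightarrow> ('a \<times> 'a) set"
  cmp :: "'o \<Rightarrow> 'o \<Rightarrow> 'o \<Rightarrow> 'a \<Rightarrow> 'a \<Rightarrow> 'a"
  idn :: "'o \<Rightarrow> 'a"

definition pos_category :: "('o, 'a) pcat \<Rightarrow> bool" where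
  "pos_category C \<longleftrightarrow>
     (\<forall>X\<in>obj C. \<forall>Y\<in>obj C. partial_order_on (hom C X Y) (hle C X Y)) \<and>
     (\<forall>X\<in>obj C. idn C X \<in> hom C X X) \<and>
     (\<forall>X\<in>obj C. \<forall>Y\<in>obj C. \<forall>Z\<in>obj C. \<forall>f\<in>hom C X Y. \<forall>g\<in>hom C Y Z.
        cmp C X Y Z g f \<in> hom C X Z) \<and>
     (\<forall>X\<in>obj C. \<forall>Y\<in>obj C. \<forall>f\<in>hom C X Y.
        cmp C X X Y f (idn C X) = f \<and> cmp C X Y Y (idn C Y) f = f) \<and>
     (\<forall>W\<in>obj C. \<forall>X\<in>obj C. \<forall>Y\<in>obj C. \<forall>Z\<in>obj C.
        \<forall>f\<in>hom C W X. \<forall>g\<in>hom C X Y. \<forall>h\<in>hom C Y Z.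
          cmp C W Y Z h (cmp C W X Y g f) = cmp C W X Z (cmp C X Y Z h g) f) \<and>
     (\<forall>X\<in>obj C. \<forall>Y\<in>obj C. \<forall>Z\<in>obj C. \<forall>f f' g g'.
        (f, f') \<in> hle C X Y \<longrightarrow> (g, g') \<in> hle C Y Z \<longrightarrow>
          (cmp C X Y Z g f, cmp C X Y Z g' f') \<in> hle C X Z)"

definition full_sub :: "('o, 'a) pcat \<Rightarrow> ('o \<Rightarrow> bool) \<Rightarrow> ('o, 'a) pcat" where
  "full_sub C Q = C\<lparr>obj := {X \<in> obj C. Q X}\<rparr>"

record ('o, 'a, 'p, 'b) pfun =
  fobj :: "'o \<Rightarrow> 'p"
  fmap :: "'o \<Rightarrow> 'o \<Rightarrow> 'a \<Rightarrow> 'b"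

definition pos_functor ::
  "('o, 'a) pcat \<Rightarrow> ('p, 'b) pcat \<Rightarrow> ('o, 'a, 'p, 'b) pfun \<Rightarrow> bool" where
  "pos_functor C D F \<longleftrightarrow>
     (\<forall>X\<in>obj C. fobj F X \<in> obj D) \<and>
     (\<forall>X\<in>obj C. \<forall>Y\<in>obj C. \<forall>f\<in>hom C X Y. fmap F X Y f \<in> hom D (fobj F X) (fobj F Y)) \<and>
     (\<forall>X\<in>obj C. \<forall>Y\<in>obj C. \<forall>f g. (f, g) \<in> hle C X Y \<longrightarrow>
        (fmap F X Y f, fmap F X Y g) \<in> hle D (fobj F X) (fobj F Y)) \<and>
     (\<forall>X\<in>obj C. fmap F X X (idn C X) = idn D (fobj F X)) \<and>
     (\<forall>X\<in>obj C. \<forall>Y\<in>obj C. \<forall>Z\<in>obj C. \<forall>f\<in>hom C X Y. \<forall>g\<in>hom C Y Z.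
        fmap F X Z (cmp C X Y Z g f) =
          cmp D (fobj F X) (fobj F Y) (fobj F Z) (fmap F Y Z g) (fmap F X Y f))"

definition id_functor :: "('o, 'a, 'o, 'a) pfun" where
  "id_functor = \<lparr>fobj = (\<lambda>X. X), fmap = (\<lambda>X Y f. f)\<rparr>"

definition comp_functor ::
  "('p, 'b, 'q, 'c) pfun \<Rightarrow> ('o, 'a, 'p, 'b) pfun \<Rightarrow> ('o, 'a, 'q, 'c) pfun" where
  "comp_functor G F =
     \<lparr>fobj = (\<lambda>X. fobj G (fobj F X)),
      fmap = (\<lambda>X Y f. fmap G (fobj F X) (fobj F Y) (fmap F X Y f))\<rparr>"

definition is_iso :: "('o, 'a) pcat \<Rightarrow> 'o \<Rightarrow> 'o \<Rightarrow> 'a \<Rightarrow> bool" where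
  "is_iso C X Y f \<longleftrightarrow> f \<in> hom C X Y \<and>
     (\<exists>g\<in>hom C Y X. cmp C X Y X g f = idn C X \<and> cmp C Y X Y f g = idn C Y)"

text \<open>
  Since the forgetful functor from posets to sets is faithful, an enriched natural
  transformation is the same as an ordinary one.
\<close>

definition naturally_isomorphic ::
  "('o, 'a) pcat \<Rightarrow> ('p, 'b) pcat \<Rightarrow> ('o, 'a, 'p, 'b) pfun \<Rightarrow> ('o, 'a, 'p, 'b) pfun \<Rightarrow> bool" where
  "naturally_isomorphic C D F G \<longleftrightarrow>
     (\<exists>\<tau>. (\<forall>X\<in>obj C. is_iso D (fobj F X) (fobj G X) (\<tau> X)) \<and>
       (\<forall>X\<in>obj C. \<forall>Y\<in>obj C. \<forall>f\<in>hom C X Y.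
          cmp D (fobj F X) (fobj F Y) (fobj G Y) (\<tau> Y) (fmap F X Y f) =
          cmp D (fobj F X) (fobj G X) (fobj G Y) (fmap G X Y f) (\<tau> X)))"

definition pos_equivalent :: "('o, 'a) pcat \<Rightarrow> ('p, 'b) pcat \<Rightarrow> bool" where
  "pos_equivalent C D \<longleftrightarrow> pos_category C \<and> pos_category D \<and>
     (\<exists>F G. pos_functor C D F \<and> pos_functor D C G \<and>
        naturally_isomorphic C C (comp_functor G F) id_functor \<and>
        naturally_isomorphic D D (comp_functor F G) id_functor)"


section \<open>The category of pseudocongruences\<close>

text \<open>
  For a cospan \<open>f : X \<rightarrow> Z\<close>, \<open>g : Y \<rightarrow> Z\<close>: the conical case of a weak weighted limit. Only
  existence of the factorization is asked for, neither uniqueness nor order reflection.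
\<close>

definition weak_pullback ::
  "('o, 'a) pcat \<Rightarrow> 'o \<Rightarrow> 'o \<Rightarrow> 'o \<Rightarrow> 'a \<Rightarrow> 'a \<Rightarrow> 'o \<Rightarrow> 'a \<Rightarrow> 'a \<Rightarrow> bool" where
  "weak_pullback C X Y Z f g P d0 d1 \<longleftrightarrow>
     P \<in> obj C \<and> d0 \<in> hom C P X \<and> d1 \<in> hom C P Y \<and> cmp C P X Z f d0 = cmp C P Y Z g d1 \<and>
     (\<forall>A\<in>obj C. \<forall>e0\<in>hom C A X. \<forall>e1\<in>hom C A Y. cmp C A X Z f e0 = cmp C A Y Z g e1 \<longrightarrow>
        (\<exists>u\<in>hom C A P. cmp C A P X d0 u = e0 \<and> cmp C A P Y d1 u = e1))"

record ('o, 'a) ppair =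
  base :: 'o
  rel :: 'o
  leg0 :: 'a
  leg1 :: 'a

text \<open>
  Any two weak pullbacks of the same cospan factor through each other, so the transitivity
  condition does not depend on the weak pullback chosen.
\<close>

definition pseudocongruence :: "('o, 'a) pcat \<Rightarrow> ('o, 'a) ppair \<Rightarrow> bool" where
  "pseudocongruence C K \<longleftrightarrow>
     (let X = base K; R = rel K; r0 = leg0 K; r1 = leg1 K in
       X \<in> obj C \<and> R \<in> obj C \<and> r0 \<in> hom C R X \<and> r1 \<in> hom C R X \<and>
       (\<forall>A\<in>obj C. \<forall>a0 a1. (a0, a1) \<in> hle C A X \<longrightarrow>
          (\<exists>u\<in>hom C A R. cmp C A R X r0 u = a0 \<and> cmp C A R X r1 u = a1)) \<and>
       (\<exists>P d0 d1. weak_pullback C R R X r1 r0 P d0 d1 \<and>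
          (\<exists>\<tau>\<in>hom C P R.
             cmp C P R X r0 \<tau> = cmp C P R X r0 d0 \<and>
             cmp C P R X r1 \<tau> = cmp C P R X r1 d1)))"

definition ex_arr :: "('o, 'a) pcat \<Rightarrow> ('o, 'a) ppair \<Rightarrow> ('o, 'a) ppair \<Rightarrow> 'a set" where
  "ex_arr C K L = {f \<in> hom C (base K) (base L). \<exists>h\<in>hom C (rel K) (rel L).
     cmp C (rel K) (rel L) (base L) (leg0 L) h = cmp C (rel K) (base K) (base L) f (leg0 K) \<and>
     cmp C (rel K) (rel L) (base L) (leg1 L) h = cmp C (rel K) (base K) (base L) f (leg1 K)}"

definition ex_pre :: "('o, 'a) pcat \<Rightarrow> ('o, 'a) ppair \<Rightarrow> ('o, 'a) ppair \<Rightarrow> ('a \<times> 'a) set" where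
  "ex_pre C K L = {(f, g). f \<in> ex_arr C K L \<and> g \<in> ex_arr C K L \<and>
     (\<exists>s\<in>hom C (base K) (rel L).
        cmp C (base K) (rel L) (base L) (leg0 L) s = f \<and>
        cmp C (base K) (rel L) (base L) (leg1 L) s = g)}"

definition ex_eq :: "('o, 'a) pcat \<Rightarrow> ('o, 'a) ppair \<Rightarrow> ('o, 'a) ppair \<Rightarrow> ('a \<times> 'a) set" where
  "ex_eq C K L = ex_pre C K L \<inter> (ex_pre C K L)\<inverse>"

abbreviation ex_class ::
  "('o, 'a) pcat \<Rightarrow> ('o, 'a) ppair \<Rightarrow> ('o, 'a) ppair \<Rightarrow> 'a \<Rightarrow> 'a set" where
  "ex_class C K L f \<equiv> ex_eq C K L `` {f}"

text \<open>
  Composition is lifted to classes as in \<^theory>\<open>HOL.Equiv_Relations\<close>: the union below is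
  over classes that all coincide.
\<close>

definition ex_cat :: "('o, 'a) pcat \<Rightarrow> (('o, 'a) ppair, 'a set) pcat" where
  "ex_cat C = \<lparr>
     obj = {K. pseudocongruence C K},
     hom = (\<lambda>K L. ex_arr C K L // ex_eq C K L),
     hle = (\<lambda>K L. {(ex_class C K L f, ex_class C K L g) | f g. (f, g) \<in> ex_pre C K L}),
     cmp = (\<lambda>K L M G F. \<Union>f\<in>F. \<Union>g\<in>G. ex_class C K M (cmp C (base K) (base L) (base M) g f)),
     idn = (\<lambda>K. ex_class C K K (idn C (base K)))\<rparr>"


section \<open>Varieties of ordered algebras\<close>

record 'f signature =
  syms :: "'f set"
  arity :: "'f \<Rightarrow> nat"

datatype ('f, 'v) tm = Var 'v | Fn 'f "('f, 'v) tm list"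

fun wf_tm :: "'f signature \<Rightarrow> ('f, 'v) tm \<Rightarrow> bool" where
  "wf_tm \<Sigma> (Var x) \<longleftrightarrow> True"
| "wf_tm \<Sigma> (Fn f ts) \<longleftrightarrow> f \<in> syms \<Sigma> \<and> length ts = arity \<Sigma> f \<and> (\<forall>t\<in>set ts. wf_tm \<Sigma> t)"

record ('f, 'u) alg =
  elems :: "'u set"
  ord :: "('u \<times> 'u) set"
  opn :: "'f \<Rightarrow> 'u list \<Rightarrow> 'u"

definition ordered_algebra :: "'f signature \<Rightarrow> ('f, 'u) alg \<Rightarrow> bool" where
  "ordered_algebra \<Sigma> A \<longleftrightarrow>
     partial_order_on (elems A) (ord A) \<and>
     opn A \<in> (\<Pi>\<^sub>E f\<in>syms \<Sigma>. {xs \<in> lists (elems A). length xs = arity \<Sigma> f} \<rightarrow>\<^sub>E elems A) \<and>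
     (\<forall>f\<in>syms \<Sigma>. \<forall>xs ys. length xs = arity \<Sigma> f \<longrightarrow>
        list_all2 (\<lambda>x y. (x, y) \<in> ord A) xs ys \<longrightarrow> (opn A f xs, opn A f ys) \<in> ord A)"

primrec tm_val :: "('f, 'u) alg \<Rightarrow> ('v \<Rightarrow> 'u) \<Rightarrow> ('f, 'v) tm \<Rightarrow> 'u" where
  "tm_val A \<nu> (Var x) = \<nu> x"
| "tm_val A \<nu> (Fn f ts) = opn A f (map (tm_val A \<nu>) ts)"

text \<open>A pair \<open>(s, t)\<close> stands for the inequation \<open>s \<le> t\<close>.\<close>

definition satisfies :: "('f, 'u) alg \<Rightarrow> (('f, 'v) tm \<times> ('f, 'v) tm) set \<Rightarrow> bool" where
  "satisfies A E \<longleftrightarrow>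
     (\<forall>(s, t)\<in>E. \<forall>\<nu>. range \<nu> \<subseteq> elems A \<longrightarrow> (tm_val A \<nu> s, tm_val A \<nu> t) \<in> ord A)"

definition mono_maps :: "'u set \<Rightarrow> ('u \<times> 'u) set \<Rightarrow> 'u set \<Rightarrow> ('u \<times> 'u) set \<Rightarrow> ('u \<Rightarrow> 'u) set" where
  "mono_maps X r Y s = {f \<in> X \<rightarrow>\<^sub>E Y. \<forall>(x, y)\<in>r. (f x, f y) \<in> s}"

definition pointwise :: "'u set \<Rightarrow> ('u \<times> 'u) set \<Rightarrow> (('u \<Rightarrow> 'u) \<times> ('u \<Rightarrow> 'u)) set" where
  "pointwise X s = {(f, g). \<forall>x\<in>X. (f x, g x) \<in> s}"

definition alg_hom :: "'f signature \<Rightarrow> ('f, 'u) alg \<Rightarrow> ('f, 'u) alg \<Rightarrow> ('u \<Rightarrow> 'u) set" where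
  "alg_hom \<Sigma> A B = {h \<in> mono_maps (elems A) (ord A) (elems B) (ord B).
     \<forall>f\<in>syms \<Sigma>. \<forall>xs\<in>lists (elems A). length xs = arity \<Sigma> f \<longrightarrow>
       h (opn A f xs) = opn B f (map h xs)}"

text \<open>
  Smallness of sets of elements of \<open>'u\<close>. Examples of size universes are the collection of all
  subsets of an infinite type and, more generally, the collection of all subsets of cardinality
  below a given uncountable cardinal; if \<open>'u\<close> is a Grothendieck universe, the sets belonging to
  that universe (the small sets in the usual sense) are of the latter kind.
\<close>

definition size_universe :: "'u set set \<Rightarrow> bool" where
  "size_universe U \<longleftrightarrow> (\<forall>A B. A \<in> U \<longrightarrow> B \<lesssim> A \<longrightarrow> B \<in> U) \<and> (\<exists>A\<in>U. infinite A)"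

definition variety ::
  "'u set set \<Rightarrow> 'f signature \<Rightarrow> (('f, 'v) tm \<times> ('f, 'v) tm) set \<Rightarrow>
   (('f, 'u) alg, 'u \<Rightarrow> 'u) pcat" where
  "variety U \<Sigma> E = \<lparr>
     obj = {A. ordered_algebra \<Sigma> A \<and> elems A \<in> U \<and> satisfies A E},
     hom = alg_hom \<Sigma>,
     hle = (\<lambda>A B. pointwise (elems A) (ord B) \<inter> alg_hom \<Sigma> A B \<times> alg_hom \<Sigma> A B),
     cmp = (\<lambda>A B C g f. compose (elems A) g f),
     idn = (\<lambda>A. restrict (\<lambda>x. x) (elems A))\<rparr>"

text \<open>
  \<open>A\<close>, with unit \<open>\<eta>\<close>, is a value of the (enriched) left adjoint to the forgetful functor from
  a category \<open>V\<close> of ordered algebras to posets at the poset \<open>(X, r)\<close>: restriction along \<open>\<eta>\<close>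
  is an isomorphism of posets from \<open>hom V A B\<close> to the poset of monotone maps from \<open>(X, r)\<close> to
  the underlying poset of \<open>B\<close>, for all \<open>B\<close>.
\<close>

definition free_on ::
  "(('f, 'u) alg, 'u \<Rightarrow> 'u) pcat \<Rightarrow> ('f, 'u) alg \<Rightarrow> 'u set \<Rightarrow> ('u \<times> 'u) set \<Rightarrow> ('u \<Rightarrow> 'u) \<Rightarrow> bool"
where
  "free_on V A X r \<eta> \<longleftrightarrow>
     A \<in> obj V \<and> \<eta> \<in> mono_maps X r (elems A) (ord A) \<and>
     (\<forall>B\<in>obj V.
        bij_betw (\<lambda>h. compose X h \<eta>) (hom V A B) (mono_maps X r (elems B) (ord B)) \<and>
        (\<forall>h\<in>hom V A B. \<forall>k\<in>hom V A B.
           (h, k) \<in> hle V A B \<longleftrightarrow> (compose X h \<eta>, compose X k \<eta>) \<in> pointwise X (ord B)))"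

definition free_on_discrete ::
  "'u set set \<Rightarrow> (('f, 'u) alg, 'u \<Rightarrow> 'u) pcat \<Rightarrow> ('f, 'u) alg \<Rightarrow> bool" where
  "free_on_discrete U V A \<longleftrightarrow> (\<exists>X\<in>U. \<exists>\<eta>. free_on V A X (Id_on X) \<eta>)"

end

(*
  The equivalence is the functor P_ex -> V sending a pseudocongruence (X, R) to the quotient of X
  by the preorder rho = {(r0 z, r1 z) | z in R}. Testing on the free algebra on one generator
  shows that conditions (1) and (2) say exactly that rho contains the order of X and is
  transitive; it is compatible with the operations because r0 and r1 are homomorphisms. Algebras
  free on a discrete poset are projective with respect to surjections, so homomorphisms between
  the quotients, inequalities between them, and the data f-bar and Sigma of P_ex all lift: the
  functor is full and an order embedding on homs. Every algebra B is hit up to isomorphism: let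
  e : X -> B be the free algebra on the elements of B and R the free algebra on the set of pairs
  (x, y) with e x <= e y. The free algebras themselves are quotients of term algebras.
*)
theory Submission
  imports Defs
begin

text \<open>The unit, associativity and order laws of \<open>P_ex\<close> are awkward to check
  directly: its homs consist of classes, and transitivity of its order rests on weak pullbacks. They
  are instead reflected from V along a functor that is bijective and order reflecting on homs. All
  existence clauses in \<open>P_ex\<close> turn into pointwise statements about rho, since
  projectivity upgrades pointwise witnesses to homomorphisms.

  The other constraint is size and typing. Every algebra of V has its carrier in one fixed type and
  in \<open>U\<close>, whereas terms, pairs and equivalence classes live in other types. Hence
  quotients are formed as images of a map whose kernel is the symmetric part of a preorder and whose
  values lie in a prescribed set; smallness is measured by injections; and terms are coded in an
  infinite member of \<open>U\<close>, which carries an injective pairing. Terms are preordered by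
  validity in all algebras of V rather than by derivability, which makes evaluation monotone by
  definition and leaves only a substitution argument for the inequations.\<close>

section \<open>Equivalences of categories enriched in posets\<close>

lemma
  assumes "pos_category C"
  shows pos_category_po: "X \<in> obj C \<Longrightarrow> Y \<in> obj C \<Longrightarrow> partial_order_on (hom C X Y) (hle C X Y)"
    and pos_category_idn: "X \<in> obj C \<Longrightarrow> idn C X \<in> hom C X X"
    and pos_category_cmp: "\<lbrakk>X \<in> obj C; Y \<in> obj C; Z \<in> obj C; f \<in> hom C X Y; g \<in> hom C Y Z\<rbrakk>
      \<Longrightarrow> cmp C X Y Z g f \<in> hom C X Z"
    and pos_category_idr: "\<lbrakk>X \<in> obj C; Y \<in> obj C; f \<in> hom C X Y\<rbrakk> \<Longrightarrow> cmp C X X Y f (idn C X) = f"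
    and pos_category_idl: "\<lbrakk>X \<in> obj C; Y \<in> obj C; f \<in> hom C X Y\<rbrakk> \<Longrightarrow> cmp C X Y Y (idn C Y) f = f"
    and pos_category_assoc: "\<lbrakk>W \<in> obj C; X \<in> obj C; Y \<in> obj C; Z \<in> obj C;
        f \<in> hom C W X; g \<in> hom C X Y; h \<in> hom C Y Z\<rbrakk>
      \<Longrightarrow> cmp C W Y Z h (cmp C W X Y g f) = cmp C W X Z (cmp C X Y Z h g) f"
    and pos_category_mono: "\<lbrakk>X \<in> obj C; Y \<in> obj C; Z \<in> obj C;
        (f, f') \<in> hle C X Y; (g, g') \<in> hle C Y Z\<rbrakk>
      \<Longrightarrow> (cmp C X Y Z g f, cmp C X Y Z g' f') \<in> hle C X Z"
  using assms unfolding pos_category_def by simp_all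

text \<open>The source \<open>C\<close> is only assumed to have identities and composites in the
  right homs; its category axioms are a consequence. The membership clauses in \<open>F_le\<close>
  keep pairs from outside the homs out of \<open>hle C\<close>.\<close>

locale order_ff_functor =
  fixes C :: "('o, 'a) pcat" and D :: "('p, 'b) pcat"
    and Fo :: "'o \<Rightarrow> 'p" and Fm :: "'o \<Rightarrow> 'o \<Rightarrow> 'a \<Rightarrow> 'b"
  assumes D: "pos_category D"
    and F_obj: "K \<in> obj C \<Longrightarrow> Fo K \<in> obj D"
    and F_bij: "K \<in> obj C \<Longrightarrow> L \<in> obj C \<Longrightarrow> bij_betw (Fm K L) (hom C K L) (hom D (Fo K) (Fo L))"
    and F_le: "K \<in> obj C \<Longrightarrow> L \<in> obj C \<Longrightarrow> (f, g) \<in> hle C K L \<longleftrightarrow>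
      f \<in> hom C K L \<and> g \<in> hom C K L \<and> (Fm K L f, Fm K L g) \<in> hle D (Fo K) (Fo L)"
    and idn_hom: "K \<in> obj C \<Longrightarrow> idn C K \<in> hom C K K"
    and F_idn: "K \<in> obj C \<Longrightarrow> Fm K K (idn C K) = idn D (Fo K)"
    and cmp_hom: "\<lbrakk>K \<in> obj C; L \<in> obj C; M \<in> obj C; f \<in> hom C K L; g \<in> hom C L M\<rbrakk>
      \<Longrightarrow> cmp C K L M g f \<in> hom C K M"
    and F_cmp: "\<lbrakk>K \<in> obj C; L \<in> obj C; M \<in> obj C; f \<in> hom C K L; g \<in> hom C L M\<rbrakk>
      \<Longrightarrow> Fm K M (cmp C K L M g f) = cmp D (Fo K) (Fo L) (Fo M) (Fm L M g) (Fm K L f)"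
begin

lemma F_hom: "\<lbrakk>K \<in> obj C; L \<in> obj C; f \<in> hom C K L\<rbrakk> \<Longrightarrow> Fm K L f \<in> hom D (Fo K) (Fo L)"
  using F_bij bij_betwE by metis

lemma F_eq: "\<lbrakk>K \<in> obj C; L \<in> obj C; f \<in> hom C K L; g \<in> hom C K L; Fm K L f = Fm K L g\<rbrakk> \<Longrightarrow> f = g"
  using F_bij by (meson bij_betw_imp_inj_on inj_onD)

definition F_inv :: "'o \<Rightarrow> 'o \<Rightarrow> 'b \<Rightarrow> 'a" where
  "F_inv K L = inv_into (hom C K L) (Fm K L)"

lemma F_inv_hom: "\<lbrakk>K \<in> obj C; L \<in> obj C; f \<in> hom D (Fo K) (Fo L)\<rbrakk> \<Longrightarrow> F_inv K L f \<in> hom C K L"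
  unfolding F_inv_def by (metis F_bij bij_betw_imp_surj_on inv_into_into)

lemma F_F_inv: "\<lbrakk>K \<in> obj C; L \<in> obj C; f \<in> hom D (Fo K) (Fo L)\<rbrakk> \<Longrightarrow> Fm K L (F_inv K L f) = f"
  unfolding F_inv_def by (metis F_bij bij_betw_inv_into_right)

text \<open>\<open>Fm\<close> is injective on homs, so each equation of \<open>C\<close> may be
  checked after applying it, where it is an axiom of \<open>D\<close>. Likewise the orders on homs
  are pulled back along injections.\<close>

lemma pos_category_source: "pos_category C"
  unfolding pos_category_def
proof (intro conjI ballI allI impI)
  fix K L assume KL: "K \<in> obj C" "L \<in> obj C"
  have po: "partial_order_on (hom D (Fo K) (Fo L)) (hle D (Fo K) (Fo L))"
    using KL pos_category_po[OF D] F_obj by blast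
  show "partial_order_on (hom C K L) (hle C K L)"
    unfolding partial_order_on_def preorder_on_def
  proof (intro conjI)
    show "hle C K L \<subseteq> hom C K L \<times> hom C K L" using F_le[OF KL] by auto
    show "refl_on (hom C K L) (hle C K L)"
      using F_le[OF KL] partial_order_onD(1)[OF po] F_hom[OF KL] by (auto simp: refl_on_def)
    show "trans (hle C K L)"
      using F_le[OF KL] partial_order_onD(2)[OF po] unfolding trans_def by blast
    show "antisym (hle C K L)"
      using F_le[OF KL] partial_order_onD(3)[OF po] F_eq[OF KL] unfolding antisym_def by blast
  qed
next
  fix K L f assume "K \<in> obj C" "L \<in> obj C" "f \<in> hom C K L"
  then show "cmp C K K L f (idn C K) = f" "cmp C K L L (idn C L) f = f"
    by (auto intro!: F_eq[of K L] simp: cmp_hom idn_hom F_cmp F_idn F_hom F_obj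
        pos_category_idr[OF D] pos_category_idl[OF D])
next
  fix J K L M f g h
  assume "J \<in> obj C" "K \<in> obj C" "L \<in> obj C" "M \<in> obj C"
    "f \<in> hom C J K" "g \<in> hom C K L" "h \<in> hom C L M"
  then show "cmp C J L M h (cmp C J K L g f) = cmp C J K M (cmp C K L M h g) f"
    by (intro F_eq[of J M]) (simp_all add: cmp_hom F_cmp F_hom F_obj pos_category_assoc[OF D])
next
  fix K L M f f' g g'
  assume "K \<in> obj C" "L \<in> obj C" "M \<in> obj C" "(f, f') \<in> hle C K L" "(g, g') \<in> hle C L M"
  then show "(cmp C K L M g f, cmp C K L M g' f') \<in> hle C K M"
    by (simp add: F_le cmp_hom F_cmp F_obj pos_category_mono[OF D])
qed (simp_all add: idn_hom cmp_hom)

text \<open>A fully faithful, essentially surjective functor has a pseudo-inverse: choose an object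
  and an isomorphism over every \<open>B\<close>, and transport arrows along these choices.\<close>

lemma pos_equivalent_source:
  assumes "\<And>B. B \<in> obj D \<Longrightarrow> \<exists>K\<in>obj C. \<exists>f. is_iso D (Fo K) B f"
  shows "pos_equivalent D C"
proof -
  have "\<forall>B. \<exists>K f g. B \<in> obj D \<longrightarrow> K \<in> obj C \<and> f \<in> hom D (Fo K) B \<and> g \<in> hom D B (Fo K) \<and>
      cmp D (Fo K) B (Fo K) g f = idn D (Fo K) \<and> cmp D B (Fo K) B f g = idn D B"
    using assms unfolding is_iso_def by blast
  then obtain Go \<epsilon> \<delta> where G: "\<And>B. B \<in> obj D \<Longrightarrow> Go B \<in> obj C"
    and \<epsilon>: "\<And>B. B \<in> obj D \<Longrightarrow> \<epsilon> B \<in> hom D (Fo (Go B)) B"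
    and \<delta>: "\<And>B. B \<in> obj D \<Longrightarrow> \<delta> B \<in> hom D B (Fo (Go B))"
    and \<delta>\<epsilon>: "\<And>B. B \<in> obj D \<Longrightarrow> cmp D (Fo (Go B)) B (Fo (Go B)) (\<delta> B) (\<epsilon> B) = idn D (Fo (Go B))"
    and \<epsilon>\<delta>: "\<And>B. B \<in> obj D \<Longrightarrow> cmp D B (Fo (Go B)) B (\<epsilon> B) (\<delta> B) = idn D B"
    by metis
  \<comment> \<open>Conjugation by the chosen isomorphisms: this is to be the image under
    \<open>Fm\<close> of the value of the inverse functor at \<open>f\<close>.\<close>
  define H where "H A B f = cmp D (Fo (Go A)) B (Fo (Go B)) (\<delta> B) (cmp D (Fo (Go A)) A B f (\<epsilon> A))"
    for A B f
  define Gm where "Gm A B f = F_inv (Go A) (Go B) (H A B f)" for A B f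
  note Dc = pos_category_cmp[OF D] and Da = pos_category_assoc[OF D]
  have H: "H A B f \<in> hom D (Fo (Go A)) (Fo (Go B))"
    if "A \<in> obj D" "B \<in> obj D" "f \<in> hom D A B" for A B f
    unfolding H_def using that by (meson Dc F_obj G \<delta> \<epsilon>)
  have Gm: "Gm A B f \<in> hom C (Go A) (Go B)" "Fm (Go A) (Go B) (Gm A B f) = H A B f"
    if "A \<in> obj D" "B \<in> obj D" "f \<in> hom D A B" for A B f
    unfolding Gm_def using that by (simp_all add: F_inv_hom F_F_inv G H)
  \<comment> \<open>Naturality of \<epsilon>. The same equation yields compatibility of
    \<open>H\<close> with composition and naturality on the side of \<open>C\<close>.\<close>
  have \<epsilon>H: "cmp D (Fo (Go A)) (Fo (Go B)) B (\<epsilon> B) (H A B f) = cmp D (Fo (Go A)) A B f (\<epsilon> A)"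
    if "A \<in> obj D" "B \<in> obj D" "f \<in> hom D A B" for A B f
    unfolding H_def using that
    by (simp add: Da[of _ _ _ B] G F_obj \<epsilon> \<delta> Dc \<epsilon>\<delta> pos_category_idl[OF D])
  have H_le: "(H A B f, H A B g) \<in> hle D (Fo (Go A)) (Fo (Go B))"
    if "A \<in> obj D" "B \<in> obj D" "(f, g) \<in> hle D A B" for A B f g
  proof -
    have refl: "(k, k) \<in> hle D A B" if "A \<in> obj D" "B \<in> obj D" "k \<in> hom D A B" for A B k
      using pos_category_po[OF D that(1,2)] that(3) by (meson partial_order_onD(1) refl_onD)
    show ?thesis
      unfolding H_def using that
      by (intro pos_category_mono[OF D]) (simp_all add: G F_obj \<epsilon> \<delta> refl)
  qed
  have H_idn: "H A A (idn D A) = idn D (Fo (Go A))" if "A \<in> obj D" for A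
    unfolding H_def using that by (simp add: pos_category_idl[OF D] G F_obj \<epsilon> \<delta>\<epsilon>)
  have H_cmp: "H A B' (cmp D A B B' g f) = cmp D (Fo (Go A)) (Fo (Go B)) (Fo (Go B')) (H B B' g) (H A B f)"
    if "A \<in> obj D" "B \<in> obj D" "B' \<in> obj D" "f \<in> hom D A B" "g \<in> hom D B B'" for A B B' f g
  proof -
    have "cmp D (Fo (Go A)) (Fo (Go B)) (Fo (Go B')) (H B B' g) (H A B f)
      = cmp D (Fo (Go A)) B' (Fo (Go B')) (\<delta> B')
         (cmp D (Fo (Go A)) (Fo (Go B)) B' (cmp D (Fo (Go B)) B B' g (\<epsilon> B)) (H A B f))"
      unfolding H_def[of B B'] using that by (intro Da[symmetric]) (simp_all add: G F_obj \<delta> \<epsilon> H Dc)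
    also have "cmp D (Fo (Go A)) (Fo (Go B)) B' (cmp D (Fo (Go B)) B B' g (\<epsilon> B)) (H A B f)
      = cmp D (Fo (Go A)) B B' g (cmp D (Fo (Go A)) (Fo (Go B)) B (\<epsilon> B) (H A B f))"
      using that by (intro Da[symmetric]) (simp_all add: G F_obj \<delta> \<epsilon> H Dc)
    also have "\<dots> = cmp D (Fo (Go A)) A B' (cmp D A B B' g f) (\<epsilon> A)"
      using that by (simp add: \<epsilon>H Da G F_obj \<epsilon>)
    finally show ?thesis unfolding H_def[of A B'] by simp
  qed
  let ?F = "\<lparr>fobj = Fo, fmap = Fm\<rparr>" and ?G = "\<lparr>fobj = Go, fmap = Gm\<rparr>"
  have F: "pos_functor C D ?F"
    unfolding pos_functor_def by (auto simp: F_obj F_hom F_le F_idn F_cmp)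
  have idn_D: "idn D A \<in> hom D A A" if "A \<in> obj D" for A
    using pos_category_idn[OF D that] .
  have hle_D: "f \<in> hom D A B" "g \<in> hom D A B"
    if "A \<in> obj D" "B \<in> obj D" "(f, g) \<in> hle D A B" for A B f g
    using partial_order_onD(4)[OF pos_category_po[OF D that(1,2)]] that(3) by auto
  have "pos_functor D C ?G"
    unfolding pos_functor_def
  proof (intro conjI ballI allI impI, goal_cases)
    case (3 A B f g)
    then show ?case using hle_D[OF 3] by (simp add: F_le G Gm H_le)
  next
    case (4 A)
    then have "Gm A A (idn D A) = idn C (Go A)"
      by (intro F_eq[of "Go A" "Go A"]) (simp_all add: G Gm idn_D idn_hom H_idn F_idn)
    then show ?case by simp
  next
    case (5 A B B' f g)
    then have "Gm A B' (cmp D A B B' g f) = cmp C (Go A) (Go B) (Go B') (Gm B B' g) (Gm A B f)"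
      by (intro F_eq[of "Go A" "Go B'"]) (simp_all add: G Gm Dc cmp_hom H_cmp F_cmp)
    then show ?case by simp
  qed (simp_all add: G Gm)
  moreover have "naturally_isomorphic D D (comp_functor ?F ?G) id_functor"
  proof -
    have "is_iso D (Fo (Go B)) B (\<epsilon> B)" if "B \<in> obj D" for B
      unfolding is_iso_def using that \<epsilon> \<delta> \<epsilon>\<delta> \<delta>\<epsilon> by blast
    then show ?thesis
      unfolding naturally_isomorphic_def comp_functor_def id_functor_def
      by (intro exI[of _ \<epsilon>]) (auto simp: Gm \<epsilon>H)
  qed
  moreover have "naturally_isomorphic C C (comp_functor ?G ?F) id_functor"
  proof -
    \<comment> \<open>The isomorphisms on the side of \<open>C\<close> are the preimages of
      \<epsilon> and \<delta> at \<open>Fo K\<close>; injectivity of \<open>Fm\<close> reflects the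
      equations they have to satisfy.\<close>
    define \<theta> where "\<theta> K = F_inv (Go (Fo K)) K (\<epsilon> (Fo K))" for K
    define \<theta>' where "\<theta>' K = F_inv K (Go (Fo K)) (\<delta> (Fo K))" for K
    have \<theta>: "\<theta> K \<in> hom C (Go (Fo K)) K" "Fm (Go (Fo K)) K (\<theta> K) = \<epsilon> (Fo K)"
      and \<theta>': "\<theta>' K \<in> hom C K (Go (Fo K))" "Fm K (Go (Fo K)) (\<theta>' K) = \<delta> (Fo K)"
      if "K \<in> obj C" for K
      unfolding \<theta>_def \<theta>'_def using that by (simp_all add: F_inv_hom F_F_inv G F_obj \<epsilon> \<delta>)
    have "is_iso C (Go (Fo K)) K (\<theta> K)" if K: "K \<in> obj C" for K
    proof -
      have "cmp C (Go (Fo K)) K (Go (Fo K)) (\<theta>' K) (\<theta> K) = idn C (Go (Fo K))"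
        using K by (intro F_eq[of "Go (Fo K)" "Go (Fo K)"])
          (simp_all add: G F_obj F_cmp F_idn \<theta> \<theta>' cmp_hom idn_hom \<delta>\<epsilon>)
      moreover have "cmp C K (Go (Fo K)) K (\<theta> K) (\<theta>' K) = idn C K"
        using K by (intro F_eq[of K K])
          (simp_all add: G F_obj F_cmp F_idn \<theta> \<theta>' cmp_hom idn_hom \<epsilon>\<delta>)
      ultimately show ?thesis unfolding is_iso_def using K \<theta> \<theta>' by blast
    qed
    moreover have "cmp C (Go (Fo K)) (Go (Fo L)) L (\<theta> L) (Gm (Fo K) (Fo L) (Fm K L f))
        = cmp C (Go (Fo K)) K L f (\<theta> K)"
      if "K \<in> obj C" "L \<in> obj C" "f \<in> hom C K L" for K L f
      using that by (intro F_eq[of "Go (Fo K)" L])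
        (simp_all add: G Gm F_obj F_hom F_cmp \<theta> cmp_hom \<epsilon>H)
    ultimately show ?thesis
      unfolding naturally_isomorphic_def comp_functor_def id_functor_def
      by (intro exI[of _ \<theta>]) auto
  qed
  ultimately show ?thesis
    unfolding pos_equivalent_def using D pos_category_source F by blast
qed

end

section \<open>Smallness\<close>

text \<open>Smallness up to injection makes sense for sets over any type, such as terms and pairs.
  For sets over the type of \<open>U\<close> itself it amounts to membership in a size
  universe.\<close>

definition small :: "'u set set \<Rightarrow> 'b set \<Rightarrow> bool" where
  "small U B \<longleftrightarrow> (\<exists>S\<in>U. B \<lesssim> S)"

lemma small_lepoll: "small U A \<Longrightarrow> B \<lesssim> A \<Longrightarrow> small U B"
  unfolding small_def using lepoll_trans by blast

lemma small_subset: "small U A \<Longrightarrow> B \<subseteq> A \<Longrightarrow> small U B"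
  by (meson small_lepoll subset_imp_lepoll)

lemma small_in_universe: "size_universe U \<Longrightarrow> A \<in> U \<longleftrightarrow> small U A"
  unfolding size_universe_def small_def by (meson lepoll_refl)

lemma lepoll_total: "A \<lesssim> B \<or> B \<lesssim> A"
  unfolding lepoll_def using ordLeq_total[OF card_of_Well_order card_of_Well_order, of A B]
  by (simp flip: card_of_ordLeq)

lemma infinite_square_lepoll: "infinite S \<Longrightarrow> S \<times> S \<lesssim> S"
  unfolding lepoll_def card_of_ordLeq
  by (rule ordIso_imp_ordLeq[OF card_of_Times_same_infinite])

text \<open>Any two sets are comparable in cardinality, so the larger of two members of
  \<open>U\<close> bounds both. Throwing in an infinite member makes the bound infinite, hence
  closed under an injective pairing.\<close>

lemma universe_directed:
  assumes "size_universe U" "small U A" "small U B"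
  obtains S where "S \<in> U" "infinite S" "A \<lesssim> S" "B \<lesssim> S"
proof -
  have join: "\<exists>S\<in>U. S1 \<lesssim> S \<and> S2 \<lesssim> S" if "S1 \<in> U" "S2 \<in> U" for S1 S2
    using lepoll_total[of S1 S2] that lepoll_refl by blast
  obtain S1 S2 S3 where "S1 \<in> U" "A \<lesssim> S1" "S2 \<in> U" "B \<lesssim> S2" and S3: "S3 \<in> U" "infinite S3"
    using assms unfolding small_def size_universe_def by metis
  then obtain S4 where "S4 \<in> U" "A \<lesssim> S4" "B \<lesssim> S4" using join lepoll_trans by metis
  then obtain S where "S \<in> U" "A \<lesssim> S" "B \<lesssim> S" "S3 \<lesssim> S" using join[OF _ S3(1)] lepoll_trans by metis
  moreover have "infinite S" 
    using \<open>S3 \<lesssim> S\<close> S3(2) by (meson infinite_le_lepoll lepoll_trans)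
  ultimately show thesis using that by blast
qed

lemma small_Times:
  assumes "size_universe U" "small U A" "small U B"
  shows "small U (A \<times> B)"
proof -
  obtain S where S: "S \<in> U" "infinite S" "A \<lesssim> S" "B \<lesssim> S" using universe_directed[OF assms] .
  have "A \<times> B \<lesssim> S \<times> S" using S(3,4) times_lepoll_mono by blast
  then show ?thesis unfolding small_def using S infinite_square_lepoll lepoll_trans by blast
qed

section \<open>Coding terms inside an infinite set\<close>

text \<open>The codes below are injective if \<open>p\<close> is an injective pairing and \<open>a \<noteq> b\<close>.\<close>

primrec encode_list :: "('a \<Rightarrow> 'a \<Rightarrow> 'a) \<Rightarrow> 'a \<Rightarrow> 'a \<Rightarrow> 'a list \<Rightarrow> 'a" where
  "encode_list p a b [] = p a a"
| "encode_list p a b (x # xs) = p b (p x (encode_list p a b xs))"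

primrec encode_tm :: "('a \<Rightarrow> 'a \<Rightarrow> 'a) \<Rightarrow> 'a \<Rightarrow> 'a \<Rightarrow> ('f \<Rightarrow> 'a) \<Rightarrow> ('v \<Rightarrow> 'a) \<Rightarrow> ('f, 'v) tm \<Rightarrow> 'a" where
  "encode_tm p a b i j (Var x) = p a (j x)"
| "encode_tm p a b i j (Fn f ts) = p b (p (i f) (encode_list p a b (map (encode_tm p a b i j) ts)))"

definition terms_over :: "'f signature \<Rightarrow> 'v set \<Rightarrow> ('f, 'v) tm set" where
  "terms_over \<Sigma> X = {t. wf_tm \<Sigma> t \<and> set2_tm t \<subseteq> X}"

lemma terms_over_Var [simp]: "Var x \<in> terms_over \<Sigma> X \<longleftrightarrow> x \<in> X"
  by (simp add: terms_over_def)

lemma terms_over_Fn [simp]: "Fn f ts \<in> terms_over \<Sigma> X \<longleftrightarrow>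
    f \<in> syms \<Sigma> \<and> length ts = arity \<Sigma> f \<and> set ts \<subseteq> terms_over \<Sigma> X"
  by (auto simp: terms_over_def)

lemma terms_over_induct [consumes 1, case_names Var Fn]:
  assumes "t \<in> terms_over \<Sigma> X"
    and "\<And>x. x \<in> X \<Longrightarrow> P (Var x)"
    and "\<And>f ts. \<lbrakk>f \<in> syms \<Sigma>; length ts = arity \<Sigma> f; set ts \<subseteq> terms_over \<Sigma> X;
      \<And>t. t \<in> set ts \<Longrightarrow> P t\<rbrakk> \<Longrightarrow> P (Fn f ts)"
  shows "P t"
  using assms(1) by (induction t) (auto intro: assms(2,3))

text \<open>An infinite \<open>S\<close> has an injective pairing and two distinct tags, which
  suffice to code lists and then terms as single elements of \<open>S\<close>, once symbols and
  variables are injected into \<open>S\<close>.\<close>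

lemma small_terms_over:
  fixes \<Sigma> :: "'f signature" and X :: "'v set" and U :: "'u set set"
  assumes "size_universe U" "small U (syms \<Sigma>)" "small U X"
  shows "small U (terms_over \<Sigma> X)"
proof -
  obtain S where S: "S \<in> U" "infinite S" "syms \<Sigma> \<lesssim> S" "X \<lesssim> S" using universe_directed[OF assms] .
  obtain i where i: "inj_on i (syms \<Sigma>)" "\<And>f. f \<in> syms \<Sigma> \<Longrightarrow> i f \<in> S"
    using S(3) unfolding lepoll_def by blast
  obtain j where j: "inj_on j X" "\<And>x. x \<in> X \<Longrightarrow> j x \<in> S"
    using S(4) unfolding lepoll_def by blast
  obtain p' where p': "inj_on p' (S \<times> S)" "p' ` (S \<times> S) \<subseteq> S"
    using infinite_square_lepoll[OF S(2)] unfolding lepoll_def by blast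
  define p where "p = curry p'"
  have p_in [simp]: "p x y \<in> S" if "x \<in> S" "y \<in> S" for x y
    using p' that unfolding p_def by auto
  have p_inj [simp]: "p x y = p x' y' \<longleftrightarrow> x = x' \<and> y = y'"
    if "x \<in> S" "y \<in> S" "x' \<in> S" "y' \<in> S" for x y x' y'
    using inj_onD[OF p'(1)] that unfolding p_def by auto
  obtain a where a: "a \<in> S" using S(2) by (metis finite.emptyI ex_in_conv)
  obtain b where b: "b \<in> S" "b \<noteq> a"
    using S(2) by (metis finite.emptyI finite_insert insertCI rev_finite_subset subsetI)
  have list_in: "encode_list p a b xs \<in> S" if "set xs \<subseteq> S" for xs
    using that by (induction xs) (auto simp: a b)
  have list_inj: "xs = ys"
    if "encode_list p a b xs = encode_list p a b ys" "set xs \<subseteq> S" "set ys \<subseteq> S"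
    for xs ys
    using that
  proof (induction xs arbitrary: ys)
    case Nil then show ?case using a b by (cases ys) (auto simp: list_in)
  next
    case (Cons x xs) then show ?case using a b by (cases ys) (auto simp: list_in)
  qed
  let ?c = "encode_tm p a b i j"
  have tm_in: "?c t \<in> S" if "t \<in> terms_over \<Sigma> X" for t
    using that
  proof (induction rule: terms_over_induct)
    case (Var x) then show ?case using j a by auto
  next
    case (Fn f ts) then show ?case using i b by (auto intro!: p_in list_in)
  qed
  have "s = t" if "s \<in> terms_over \<Sigma> X" "t \<in> terms_over \<Sigma> X" "?c s = ?c t" for s t
    using that
  proof (induction arbitrary: t rule: terms_over_induct)
    case (Var x)
    show ?case
    proof (cases t)
      case (Var y) with \<open>x \<in> X\<close> Var.prems show ?thesis
        using j a by (auto dest: inj_onD)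
    next
      case (Fn g us)
      \<comment> \<open>The pairing is injective on \<open>S\<close> only, so the tags can be
        compared only after all components of the codes are known to lie in
        \<open>S\<close>.\<close>
      then have "encode_list p a b (map ?c us) \<in> S" using Var.prems by (auto intro!: list_in tm_in)
      with Var.prems Var.hyps Fn show ?thesis using j i a b by auto
    qed
  next
    case (Fn f ts)
    then have ts: "set (map ?c ts) \<subseteq> S" using tm_in by auto
    show ?case
    proof (cases t)
      case (Var y)
      with Fn.prems Fn.hyps show ?thesis using j i a b ts by (auto simp: list_in)
    next
      case t: (Fn g us)
      then have us: "set (map ?c us) \<subseteq> S" using Fn.prems tm_in by auto
      have "i f = i g" "encode_list p a b (map ?c ts) = encode_list p a b (map ?c us)"
        using Fn.prems Fn.hyps t i b list_in[OF ts] list_in[OF us] by auto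
      then have "f = g" "map ?c ts = map ?c us"
        using Fn.prems Fn.hyps t i list_inj[OF _ ts us] by (auto dest: inj_onD)
      \<comment> \<open>The induction hypothesis gives injectivity of the coding only at members of
        \<open>ts\<close>, whence the strong form of injectivity of \<open>map\<close>.\<close>
      moreover from this(2) have "ts = us"
        using Fn.IH Fn.prems t by (intro list.inj_map_strong[of ts us ?c ?c]) auto
      ultimately show ?thesis using t by simp
    qed
  qed
  then have "inj_on ?c (terms_over \<Sigma> X)" by (auto intro: inj_onI)
  then show ?thesis unfolding small_def lepoll_def using S(1) tm_in by blast
qed

section \<open>Preordered algebras and their quotients\<close>

text \<open>The common form of the two structures to be collapsed: terms preordered by validity, and
  the base of a pseudocongruence preordered by rho. Extensionality of the operations is left out
  because \<open>Fn\<close> does not have it.\<close>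

definition preordered_algebra :: "'f signature \<Rightarrow> ('f, 'b) alg \<Rightarrow> bool" where
  "preordered_algebra \<Sigma> A \<longleftrightarrow>
     preorder_on (elems A) (ord A) \<and>
     (\<forall>f\<in>syms \<Sigma>. \<forall>xs\<in>lists (elems A). length xs = arity \<Sigma> f \<longrightarrow> opn A f xs \<in> elems A) \<and>
     (\<forall>f\<in>syms \<Sigma>. \<forall>xs ys. length xs = arity \<Sigma> f \<longrightarrow>
        list_all2 (\<lambda>x y. (x, y) \<in> ord A) xs ys \<longrightarrow> (opn A f xs, opn A f ys) \<in> ord A)"

lemma
  assumes "preordered_algebra \<Sigma> A"
  shows preordered_algebra_refl: "x \<in> elems A \<Longrightarrow> (x, x) \<in> ord A"
    and preordered_algebra_trans: "(x, y) \<in> ord A \<Longrightarrow> (y, z) \<in> ord A \<Longrightarrow> (x, z) \<in> ord A"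
    and preordered_algebra_dom: "(x, y) \<in> ord A \<Longrightarrow> x \<in> elems A \<and> y \<in> elems A"
    and preordered_algebra_opn: "\<lbrakk>f \<in> syms \<Sigma>; set xs \<subseteq> elems A; length xs = arity \<Sigma> f\<rbrakk>
      \<Longrightarrow> opn A f xs \<in> elems A"
    and preordered_algebra_mono: "\<lbrakk>f \<in> syms \<Sigma>; length xs = arity \<Sigma> f;
        list_all2 (\<lambda>x y. (x, y) \<in> ord A) xs ys\<rbrakk> \<Longrightarrow> (opn A f xs, opn A f ys) \<in> ord A"
proof -
  have A: "ord A \<subseteq> elems A \<times> elems A" "refl_on (elems A) (ord A)" "trans (ord A)"
    using assms unfolding preordered_algebra_def preorder_on_def by blast+
  show "x \<in> elems A \<Longrightarrow> (x, x) \<in> ord A" "(x, y) \<in> ord A \<Longrightarrow> (y, z) \<in> ord A \<Longrightarrow> (x, z) \<in> ord A"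
    "(x, y) \<in> ord A \<Longrightarrow> x \<in> elems A \<and> y \<in> elems A"
    using A by (blast dest: refl_onD transD)+
qed (use assms in \<open>simp_all add: preordered_algebra_def in_lists_conv_set subset_iff\<close>)

lemma ordered_algebra_iff: "ordered_algebra \<Sigma> A \<longleftrightarrow>
    preordered_algebra \<Sigma> A \<and> antisym (ord A) \<and> opn A \<in> extensional (syms \<Sigma>) \<and>
    (\<forall>f\<in>syms \<Sigma>. opn A f \<in> extensional {xs \<in> lists (elems A). length xs = arity \<Sigma> f})"
  unfolding ordered_algebra_def preordered_algebra_def partial_order_on_def PiE_def Pi_def
  by auto

section \<open>Homomorphisms between carriers of possibly different types\<close>

definition is_hom :: "'f signature \<Rightarrow> ('f, 'a) alg \<Rightarrow> ('f, 'b) alg \<Rightarrow> ('a \<Rightarrow> 'b) \<Rightarrow> bool" where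
  "is_hom \<Sigma> A B h \<longleftrightarrow> h ` elems A \<subseteq> elems B \<and> (\<forall>(x, y)\<in>ord A. (h x, h y) \<in> ord B) \<and>
     (\<forall>f\<in>syms \<Sigma>. \<forall>xs. set xs \<subseteq> elems A \<longrightarrow> length xs = arity \<Sigma> f \<longrightarrow>
        h (opn A f xs) = opn B f (map h xs))"

lemma
  assumes "is_hom \<Sigma> A B h"
  shows is_hom_in: "x \<in> elems A \<Longrightarrow> h x \<in> elems B"
    and is_hom_mono: "(x, y) \<in> ord A \<Longrightarrow> (h x, h y) \<in> ord B"
    and is_hom_opn: "\<lbrakk>f \<in> syms \<Sigma>; set xs \<subseteq> elems A; length xs = arity \<Sigma> f\<rbrakk>
      \<Longrightarrow> h (opn A f xs) = opn B f (map h xs)"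
  using assms unfolding is_hom_def by auto

lemma alg_hom_iff: "h \<in> alg_hom \<Sigma> A B \<longleftrightarrow> is_hom \<Sigma> A B h \<and> h \<in> extensional (elems A)"
  unfolding alg_hom_def mono_maps_def is_hom_def PiE_def Pi_def
  by (auto simp: in_lists_conv_set subset_iff image_subset_iff)

lemma is_hom_comp:
  assumes "is_hom \<Sigma> A B h" "is_hom \<Sigma> B C k"
  shows "is_hom \<Sigma> A C (k \<circ> h)"
  unfolding is_hom_def
proof (intro conjI ballI allI impI)
  show "(k \<circ> h) ` elems A \<subseteq> elems C"
    using is_hom_in[OF assms(1)] is_hom_in[OF assms(2)] by auto
  show "case z of (x, y) \<Rightarrow> ((k \<circ> h) x, (k \<circ> h) y) \<in> ord C" if "z \<in> ord A" for z
    using that is_hom_mono[OF assms(1)] is_hom_mono[OF assms(2)] by (cases z) simp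
  fix f xs assume f: "f \<in> syms \<Sigma>" "set xs \<subseteq> elems A" "length xs = arity \<Sigma> f"
  then have "set (map h xs) \<subseteq> elems B" using is_hom_in[OF assms(1)] by auto
  with f show "(k \<circ> h) (opn A f xs) = opn C f (map (k \<circ> h) xs)"
    by (simp add: is_hom_opn[OF assms(1)] is_hom_opn[OF assms(2)])
qed

lemma is_hom_cong:
  assumes "preordered_algebra \<Sigma> A" "\<And>x. x \<in> elems A \<Longrightarrow> h x = k x"
  shows "is_hom \<Sigma> A B h \<longleftrightarrow> is_hom \<Sigma> A B k"
proof -
  have "is_hom \<Sigma> A B k" if "is_hom \<Sigma> A B h" and eq: "\<And>x. x \<in> elems A \<Longrightarrow> h x = k x" for h k
    unfolding is_hom_def
  proof (intro conjI ballI allI impI)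
    show "k ` elems A \<subseteq> elems B" using is_hom_in[OF that(1)] eq by force
    show "case z of (x, y) \<Rightarrow> (k x, k y) \<in> ord B" if "z \<in> ord A" for z
      using is_hom_mono[OF \<open>is_hom \<Sigma> A B h\<close>] that preordered_algebra_dom[OF assms(1)] eq by force
    fix f xs assume "f \<in> syms \<Sigma>" "set xs \<subseteq> elems A" "length xs = arity \<Sigma> f"
    moreover from this have "map h xs = map k xs" using eq by auto
    ultimately show "k (opn A f xs) = opn B f (map k xs)"
      using is_hom_opn[OF that(1)] eq preordered_algebra_opn[OF assms(1)] by metis
  qed
  then show ?thesis using assms(2) by metis
qed

lemma alg_hom_restrict:
  assumes "preordered_algebra \<Sigma> A" "is_hom \<Sigma> A B h"
  shows "restrict h (elems A) \<in> alg_hom \<Sigma> A B"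
  unfolding alg_hom_iff using is_hom_cong[OF assms(1), of "restrict h (elems A)" h B] assms(2) by auto

lemma alg_hom_compose:
  assumes "preordered_algebra \<Sigma> A" "h \<in> alg_hom \<Sigma> A B" "k \<in> alg_hom \<Sigma> B C"
  shows "compose (elems A) k h \<in> alg_hom \<Sigma> A C"
proof -
  have "compose (elems A) k h = restrict (k \<circ> h) (elems A)" by (simp add: compose_def comp_def)
  then show ?thesis 
    using alg_hom_restrict[OF assms(1) is_hom_comp] assms(2,3) unfolding alg_hom_iff by metis
qed

lemma alg_hom_eqI:
  "\<lbrakk>h \<in> alg_hom \<Sigma> A B; k \<in> alg_hom \<Sigma> A C; \<And>x. x \<in> elems A \<Longrightarrow> h x = k x\<rbrakk> \<Longrightarrow> h = k"
  unfolding alg_hom_iff by (auto intro: extensionalityI)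

lemma alg_hom_in: "h \<in> alg_hom \<Sigma> A B \<Longrightarrow> x \<in> elems A \<Longrightarrow> h x \<in> elems B"
  unfolding alg_hom_iff by (blast dest: is_hom_in)

lemma alg_hom_mono: "h \<in> alg_hom \<Sigma> A B \<Longrightarrow> (x, y) \<in> ord A \<Longrightarrow> (h x, h y) \<in> ord B"
  unfolding alg_hom_iff by (blast dest: is_hom_mono)

lemma alg_hom_opn: "\<lbrakk>h \<in> alg_hom \<Sigma> A B; f \<in> syms \<Sigma>; set xs \<subseteq> elems A; length xs = arity \<Sigma> f\<rbrakk>
    \<Longrightarrow> h (opn A f xs) = opn B f (map h xs)"
  unfolding alg_hom_iff by (blast dest: is_hom_opn)

lemma tm_val_in:
  assumes "preordered_algebra \<Sigma> A" "\<nu> ` X \<subseteq> elems A" "t \<in> terms_over \<Sigma> X"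
  shows "tm_val A \<nu> t \<in> elems A"
  using assms(3)
proof (induction rule: terms_over_induct)
  case (Fn f ts) then show ?case by (auto intro!: preordered_algebra_opn[OF assms(1)])
qed (use assms(2) in auto)

lemma is_hom_tm_val:
  assumes "preordered_algebra \<Sigma> A" "is_hom \<Sigma> A B h" "\<nu> ` X \<subseteq> elems A" "t \<in> terms_over \<Sigma> X"
  shows "h (tm_val A \<nu> t) = tm_val B (h \<circ> \<nu>) t"
  using assms(4)
proof (induction rule: terms_over_induct)
  case (Fn f ts)
  then have "set (map (tm_val A \<nu>) ts) \<subseteq> elems A" using tm_val_in[OF assms(1,3)] by auto
  with Fn show ?case by (simp add: is_hom_opn[OF assms(2)] cong: map_cong)
qed simp

lemma tm_val_mono:
  assumes "preordered_algebra \<Sigma> B" "\<And>x. x \<in> X \<Longrightarrow> (\<mu> x, \<nu> x) \<in> ord B" "t \<in> terms_over \<Sigma> X"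
  shows "(tm_val B \<mu> t, tm_val B \<nu> t) \<in> ord B"
  using assms(3)
proof (induction rule: terms_over_induct)
  case (Fn f ts)
  then show ?case
    by (auto intro!: preordered_algebra_mono[OF assms(1)] simp: list_all2_conv_all_nth)
qed (use assms(2) in auto)

section \<open>Quotients by the symmetric part of a preorder\<close>

text \<open>When \<open>c\<close> has the symmetric part of the preorder as its kernel, this is the
  quotient, with classes named by values of \<open>c\<close>. Naming them this way keeps the carrier
  in the type \<open>'u\<close> instead of \<open>'b set\<close>.\<close>

definition collapse :: "'f signature \<Rightarrow> ('b \<Rightarrow> 'u) \<Rightarrow> ('f, 'b) alg \<Rightarrow> ('f, 'u) alg" where
  "collapse \<Sigma> c A = \<lparr>elems = c ` elems A, ord = map_prod c c ` ord A,
     opn = (\<lambda>f\<in>syms \<Sigma>. \<lambda>xs\<in>{xs \<in> lists (c ` elems A). length xs = arity \<Sigma> f}.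
       c (opn A f (map (inv_into (elems A) c) xs)))\<rparr>"

lemma elems_collapse [simp]: "elems (collapse \<Sigma> c A) = c ` elems A"
  by (simp add: collapse_def)

definition symmetric_kernel :: "('f, 'b) alg \<Rightarrow> ('b \<Rightarrow> 'u) \<Rightarrow> bool" where
  "symmetric_kernel A c \<longleftrightarrow>
     (\<forall>x\<in>elems A. \<forall>y\<in>elems A. c x = c y \<longleftrightarrow> (x, y) \<in> ord A \<and> (y, x) \<in> ord A)"

text \<open>Pick a representative in every class and inject the representatives into
  \<open>S\<close>. The freedom in \<open>S\<close> is what later keeps quotients inside the
  universe.\<close>

lemma exists_symmetric_kernel:
  assumes "preordered_algebra \<Sigma> A" "elems A \<lesssim> S"
  obtains c where "symmetric_kernel A c" "c ` elems A \<subseteq> S"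
proof -
  obtain i where i: "inj_on i (elems A)" "i ` elems A \<subseteq> S"
    using assms(2) unfolding lepoll_def by blast
  note A = preordered_algebra_refl[OF assms(1)] preordered_algebra_trans[OF assms(1)]
    preordered_algebra_dom[OF assms(1)]
  define r where "r x = (SOME y. (x, y) \<in> ord A \<and> (y, x) \<in> ord A)" for x
  have r: "(x, r x) \<in> ord A \<and> (r x, x) \<in> ord A" if "x \<in> elems A" for x
    unfolding r_def by (rule someI[of _ x]) (simp add: A(1)[OF that])
  then have r_in: "r x \<in> elems A" if "x \<in> elems A" for x using that A(3) by blast
  have "(x, y) \<in> ord A \<and> (y, x) \<in> ord A \<longleftrightarrow> r x = r y" if "x \<in> elems A" "y \<in> elems A" for x y
  proof
    assume *: "(x, y) \<in> ord A \<and> (y, x) \<in> ord A"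
    \<comment> \<open>Equivalent elements have the same class, so \<open>SOME\<close> is applied to
      the same predicate and returns the same representative.\<close>
    have "(x, z) \<in> ord A \<and> (z, x) \<in> ord A \<longleftrightarrow> (y, z) \<in> ord A \<and> (z, y) \<in> ord A" for z
      using * A(2) by blast
    then show "r x = r y" unfolding r_def by simp
  next
    assume "r x = r y" then show "(x, y) \<in> ord A \<and> (y, x) \<in> ord A"
      using r[OF that(1)] r[OF that(2)] A(2)[of x "r x" y] A(2)[of y "r y" x] by metis
  qed
  moreover have "i (r x) = i (r y) \<longleftrightarrow> r x = r y" if "x \<in> elems A" "y \<in> elems A" for x y
    using inj_on_eq_iff[OF i(1) r_in[OF that(1)] r_in[OF that(2)]] .
  ultimately have "symmetric_kernel A (i \<circ> r)" unfolding symmetric_kernel_def by simp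
  moreover have "(i \<circ> r) ` elems A \<subseteq> S" using i(2) r_in by auto
  ultimately show thesis using that by blast
qed

context
  fixes \<Sigma> :: "'f signature" and A :: "('f, 'b) alg" and c :: "'b \<Rightarrow> 'u"
  assumes A: "preordered_algebra \<Sigma> A" and c: "symmetric_kernel A c"
begin

private lemma c_iff: "x \<in> elems A \<Longrightarrow> y \<in> elems A \<Longrightarrow> c x = c y \<longleftrightarrow> (x, y) \<in> ord A \<and> (y, x) \<in> ord A"
  using c unfolding symmetric_kernel_def by blast

text \<open>The order of the quotient is an image, so a priori it only provides related elements
  equivalent to \<open>x\<close> and \<open>y\<close>; transitivity absorbs the difference.\<close>

lemma ord_collapse_iff:
  assumes "x \<in> elems A" "y \<in> elems A"
  shows "(c x, c y) \<in> ord (collapse \<Sigma> c A) \<longleftrightarrow> (x, y) \<in> ord A"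
proof
  assume "(c x, c y) \<in> ord (collapse \<Sigma> c A)"
  then obtain x' y' where *: "(x', y') \<in> ord A" "c x = c x'" "c y = c y'"
    by (auto simp: collapse_def)
  then have "(x, x') \<in> ord A" "(y', y) \<in> ord A"
    using c_iff assms preordered_algebra_dom[OF A *(1)] by auto
  then show "(x, y) \<in> ord A" using *(1) preordered_algebra_trans[OF A] by blast
qed (auto simp: collapse_def)

private lemma inv_c: "x \<in> elems A \<Longrightarrow> inv_into (elems A) c (c x) \<in> elems A"
  "x \<in> elems A \<Longrightarrow> (inv_into (elems A) c (c x), x) \<in> ord A \<and> (x, inv_into (elems A) c (c x)) \<in> ord A"
proof -
  assume x: "x \<in> elems A"
  show "inv_into (elems A) c (c x) \<in> elems A" using x by (simp add: inv_into_into)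
  moreover have "c (inv_into (elems A) c (c x)) = c x" using x by (simp add: f_inv_into_f)
  ultimately show "(inv_into (elems A) c (c x), x) \<in> ord A \<and> (x, inv_into (elems A) c (c x)) \<in> ord A"
    using c_iff x by blast
qed

text \<open>The chosen preimages are equivalent to the given arguments in each place, and
  monotonicity of the operation in both directions makes the results equivalent.\<close>

lemma opn_collapse:
  assumes "f \<in> syms \<Sigma>" "set xs \<subseteq> elems A" "length xs = arity \<Sigma> f"
  shows "opn (collapse \<Sigma> c A) f (map c xs) = c (opn A f xs)"
proof -
  let ?ys = "map (inv_into (elems A) c) (map c xs)"
  have le: "list_all2 (\<lambda>x y. (x, y) \<in> ord A) ?ys xs" "list_all2 (\<lambda>x y. (x, y) \<in> ord A) xs ?ys"
    using assms(2) inv_c by (auto simp: list_all2_conv_all_nth subset_iff)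
  have "c (opn A f ?ys) = c (opn A f xs)"
    using preordered_algebra_mono[OF A assms(1) _ le(1)] preordered_algebra_mono[OF A assms(1,3) le(2)]
      assms(3) by (subst c_iff) (auto dest: preordered_algebra_dom[OF A])
  moreover have "map c xs \<in> lists (c ` elems A)"
    using assms(2) by (auto simp: in_lists_conv_set subset_iff)
  ultimately show ?thesis using assms by (simp add: collapse_def)
qed

lemma is_hom_collapse: "is_hom \<Sigma> A (collapse \<Sigma> c A) c"
  unfolding is_hom_def by (auto simp: opn_collapse) (auto simp: collapse_def)

lemma ordered_algebra_collapse: "ordered_algebra \<Sigma> (collapse \<Sigma> c A)"
  unfolding ordered_algebra_iff preordered_algebra_def preorder_on_def
proof (intro conjI ballI allI impI)
  let ?Q = "collapse \<Sigma> c A"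
  have dom: "ord ?Q \<subseteq> elems ?Q \<times> elems ?Q"
    using preordered_algebra_dom[OF A] by (auto simp: collapse_def)
  then show "ord ?Q \<subseteq> elems ?Q \<times> elems ?Q" .
  show "refl_on (elems ?Q) (ord ?Q)"
    by (auto simp: refl_on_def ord_collapse_iff preordered_algebra_refl[OF A])
  show "trans (ord ?Q)"
  proof (rule transI)
    fix u v w assume *: "(u, v) \<in> ord ?Q" "(v, w) \<in> ord ?Q"
    then have "u \<in> c ` elems A" "v \<in> c ` elems A" "w \<in> c ` elems A" using dom by auto
    then obtain x y z where "u = c x" "v = c y" "w = c z" "x \<in> elems A" "y \<in> elems A" "z \<in> elems A"
      by blast
    with * show "(u, w) \<in> ord ?Q"
      using preordered_algebra_trans[OF A] by (simp add: ord_collapse_iff)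
  qed
  show "antisym (ord ?Q)"
  proof (rule antisymI)
    fix u v assume *: "(u, v) \<in> ord ?Q" "(v, u) \<in> ord ?Q"
    then have "u \<in> c ` elems A" "v \<in> c ` elems A" using dom by auto
    then obtain x y where "u = c x" "v = c y" "x \<in> elems A" "y \<in> elems A" by blast
    with * show "u = v" by (simp add: ord_collapse_iff c_iff)
  qed
  show "opn ?Q f xs \<in> elems ?Q"
    if "f \<in> syms \<Sigma>" and xs: "xs \<in> lists (elems ?Q)" and "length xs = arity \<Sigma> f" for f xs
  proof -
    obtain ys where ys: "xs = map c ys" "set ys \<subseteq> elems A"
      using xs by (auto simp: lists_image)
    with that show ?thesis using preordered_algebra_opn[OF A] by (simp add: opn_collapse)
  qed
  show "(opn ?Q f xs, opn ?Q f ys) \<in> ord ?Q"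
    if f: "f \<in> syms \<Sigma>" and len: "length xs = arity \<Sigma> f"
      and le: "list_all2 (\<lambda>x y. (x, y) \<in> ord ?Q) xs ys" for f xs ys
  proof -
    have "u \<in> c ` elems A \<and> v \<in> c ` elems A" if "(u, v) \<in> ord ?Q" for u v
      using dom that by auto
    with le have "xs \<in> lists (c ` elems A) \<and> ys \<in> lists (c ` elems A)"
      by (induction rule: list_all2_induct) simp_all
    then obtain xs' ys' where xs: "xs = map c xs'" "set xs' \<subseteq> elems A"
      and ys: "ys = map c ys'" "set ys' \<subseteq> elems A"
      by (auto simp: lists_image)
    have "list_all2 (\<lambda>x y. (x, y) \<in> ord A) xs' ys'"
      using le xs ys by (auto simp: list_all2_conv_all_nth subset_iff ord_collapse_iff[symmetric])
    then have "(opn A f xs', opn A f ys') \<in> ord A"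
      using preordered_algebra_mono[OF A f] xs len by simp
    then show ?thesis
      using f len xs ys list_all2_lengthD[OF le] preordered_algebra_dom[OF A]
      by (simp add: opn_collapse ord_collapse_iff)
  qed
qed (auto simp: collapse_def)

text \<open>A valuation in the quotient lifts along a section of \<open>c\<close>; the inequation
  holds for the lifted valuation and is pushed down by the homomorphism \<open>c\<close>.\<close>

lemma satisfies_collapse:
  fixes E :: "(('f, 'v) tm \<times> ('f, 'v) tm) set"
  assumes "satisfies A E" and wf: "\<forall>(s, t)\<in>E. wf_tm \<Sigma> s \<and> wf_tm \<Sigma> t"
  shows "satisfies (collapse \<Sigma> c A) E"
  unfolding satisfies_def
proof (intro ballI, clarify)
  fix s t and \<nu> :: "'v \<Rightarrow> 'u"
  assume st: "(s, t) \<in> E" and \<nu>: "range \<nu> \<subseteq> elems (collapse \<Sigma> c A)"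
  define \<mu> where "\<mu> = inv_into (elems A) c \<circ> \<nu>"
  have \<mu>: "range \<mu> \<subseteq> elems A" "c \<circ> \<mu> = \<nu>"
    unfolding \<mu>_def using \<nu> by (auto simp: inv_into_into f_inv_into_f fun_eq_iff image_subset_iff)
  have T: "s \<in> terms_over \<Sigma> UNIV" "t \<in> terms_over \<Sigma> UNIV"
    using wf st by (auto simp: terms_over_def)
  have "(tm_val A \<mu> s, tm_val A \<mu> t) \<in> ord A"
    using assms(1) st \<mu>(1) unfolding satisfies_def by blast
  then show "(tm_val (collapse \<Sigma> c A) \<nu> s, tm_val (collapse \<Sigma> c A) \<nu> t) \<in> ord (collapse \<Sigma> c A)"
    using is_hom_mono[OF is_hom_collapse] is_hom_tm_val[OF A is_hom_collapse \<mu>(1)] T \<mu>(2) by fastforce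
qed

text \<open>The universal property of the quotient. Antisymmetry of \<open>B\<close> forces a
  monotone map to identify equivalent elements.\<close>

lemma collapse_factor:
  assumes g: "is_hom \<Sigma> A B g" and B: "antisym (ord B)"
  obtains h where "h \<in> alg_hom \<Sigma> (collapse \<Sigma> c A) B" "\<And>x. x \<in> elems A \<Longrightarrow> h (c x) = g x"
proof -
  define h where "h = (\<lambda>u\<in>c ` elems A. g (inv_into (elems A) c u))"
  have h_c: "h (c x) = g x" if "x \<in> elems A" for x
    unfolding h_def using that inv_c[OF that] is_hom_mono[OF g] antisymD[OF B] by auto
  have "is_hom \<Sigma> (collapse \<Sigma> c A) B h"
    unfolding is_hom_def
  proof (intro conjI ballI allI impI)
    show "h ` elems (collapse \<Sigma> c A) \<subseteq> elems B"
      using h_c is_hom_in[OF g] by auto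
    show "case z of (u, v) \<Rightarrow> (h u, h v) \<in> ord B" if "z \<in> ord (collapse \<Sigma> c A)" for z
    proof -
      obtain x y where "z = (c x, c y)" "(x, y) \<in> ord A" using \<open>z \<in> _\<close> by (auto simp: collapse_def)
      then show ?thesis
        using h_c is_hom_mono[OF g] preordered_algebra_dom[OF A] by simp
    qed
    fix f xs assume f: "f \<in> syms \<Sigma>" "set xs \<subseteq> elems (collapse \<Sigma> c A)" "length xs = arity \<Sigma> f"
    then have "xs \<in> lists (c ` elems A)" by auto
    then obtain ys where ys: "xs = map c ys" "set ys \<subseteq> elems A" by (auto simp: lists_image)
    have "opn (collapse \<Sigma> c A) f xs = c (opn A f ys)" using f ys by (simp add: opn_collapse)
    then have "h (opn (collapse \<Sigma> c A) f xs) = opn B f (map g ys)"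
      using f ys preordered_algebra_opn[OF A] h_c is_hom_opn[OF g] by simp
    moreover have "map h xs = map g ys" using ys h_c by auto
    ultimately show "h (opn (collapse \<Sigma> c A) f xs) = opn B f (map h xs)" by simp
  qed
  then have "h \<in> alg_hom \<Sigma> (collapse \<Sigma> c A) B" by (simp add: alg_hom_iff h_def)
  then show thesis using that h_c by blast
qed

end

section \<open>Free algebras in a variety\<close>

lemma obj_variety:
  "obj (variety U \<Sigma> E) = {A. ordered_algebra \<Sigma> A \<and> elems A \<in> U \<and> satisfies A E}"
  by (simp add: variety_def)

lemma variety_simps [simp]:
  "hom (variety U \<Sigma> E) = alg_hom \<Sigma>"
  "hle (variety U \<Sigma> E) A B = pointwise (elems A) (ord B) \<inter> alg_hom \<Sigma> A B \<times> alg_hom \<Sigma> A B"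
  "cmp (variety U \<Sigma> E) A B C g f = compose (elems A) g f"
  "idn (variety U \<Sigma> E) A = restrict (\<lambda>x. x) (elems A)"
  by (simp_all add: variety_def)

lemma full_sub_simps [simp]:
  "obj (full_sub C Q) = {X \<in> obj C. Q X}"
  "hom (full_sub C Q) = hom C"
  "hle (full_sub C Q) = hle C"
  "cmp (full_sub C Q) = cmp C"
  "idn (full_sub C Q) = idn C"
  by (simp_all add: full_sub_def)

locale ordered_variety =
  fixes U :: "'u set set" and \<Sigma> :: "'f signature" and E :: "(('f, 'v) tm \<times> ('f, 'v) tm) set"
  assumes universe: "size_universe U" and small_syms: "small U (syms \<Sigma>)"
    and wf: "\<forall>(s, t)\<in>E. wf_tm \<Sigma> s \<and> wf_tm \<Sigma> t"
begin

abbreviation "\<V> \<equiv> variety U \<Sigma> E"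
abbreviation "\<P> \<equiv> full_sub \<V> (free_on_discrete U \<V>)"

lemma
  assumes "A \<in> obj \<V>"
  shows preordered: "preordered_algebra \<Sigma> A" and antisym_ord: "antisym (ord A)"
    and small_elems: "small U (elems A)"
  using assms small_in_universe[OF universe] by (auto simp: obj_variety ordered_algebra_iff)

lemma P_V: "A \<in> obj \<P> \<Longrightarrow> A \<in> obj \<V>"
  by simp

lemma collapse_in_variety:
  assumes "preordered_algebra \<Sigma> A" "symmetric_kernel A c" "satisfies A E" "c ` elems A \<in> U"
  shows "collapse \<Sigma> c A \<in> obj \<V>"
  using assms wf by (simp add: obj_variety ordered_algebra_collapse satisfies_collapse)

lemma alg_hom_idn: "A \<in> obj \<V> \<Longrightarrow> restrict (\<lambda>x. x) (elems A) \<in> alg_hom \<Sigma> A A"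
  by (intro alg_hom_restrict preordered) (auto simp: is_hom_def)

lemma pos_category_variety: "pos_category \<V>"
  unfolding pos_category_def
proof (intro conjI ballI allI impI)
  fix A B assume A: "A \<in> obj \<V>" and B: "B \<in> obj \<V>"
  show "partial_order_on (hom \<V> A B) (hle \<V> A B)"
    unfolding partial_order_on_def preorder_on_def
  proof (intro conjI)
    show "refl_on (hom \<V> A B) (hle \<V> A B)"
      by (auto simp: refl_on_def pointwise_def alg_hom_in preordered_algebra_refl[OF preordered[OF B]])
    show "trans (hle \<V> A B)"
      using preordered_algebra_trans[OF preordered[OF B]]
      by (simp add: trans_def pointwise_def) blast
    show "antisym (hle \<V> A B)"
      by (auto simp: antisym_def pointwise_def intro!: alg_hom_eqI antisymD[OF antisym_ord[OF B]])
  qed simp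
next
  fix A assume "A \<in> obj \<V>"
  then show "idn \<V> A \<in> hom \<V> A A" using alg_hom_idn by simp
next
  fix A B C f g assume "A \<in> obj \<V>" "f \<in> hom \<V> A B" "g \<in> hom \<V> B C"
  then show "cmp \<V> A B C g f \<in> hom \<V> A C"
    using alg_hom_compose[OF preordered] by simp
next
  fix A B f assume "A \<in> obj \<V>" and f: "f \<in> hom \<V> A B"
  then have f': "f \<in> alg_hom \<Sigma> A B" by simp
  show "cmp \<V> A A B f (idn \<V> A) = f" "cmp \<V> A B B (idn \<V> B) f = f"
    using f' by (auto simp: compose_def alg_hom_iff fun_eq_iff extensional_def is_hom_in[of \<Sigma> A B f])
next
  fix A B C D f g h assume "f \<in> hom \<V> A B" "g \<in> hom \<V> B C" "h \<in> hom \<V> C D"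
  then show "cmp \<V> A C D h (cmp \<V> A B C g f) = cmp \<V> A B D (cmp \<V> B C D h g) f"
    by (auto simp: compose_def fun_eq_iff alg_hom_in)
next
  fix A B C f f' g g'
  assume A: "A \<in> obj \<V>" and C: "C \<in> obj \<V>" and f: "(f, f') \<in> hle \<V> A B" and g: "(g, g') \<in> hle \<V> B C"
  have "(g (f x), g' (f' x)) \<in> ord C" if x: "x \<in> elems A" for x
  proof -
    have "(g (f x), g (f' x)) \<in> ord C"
      using f g x by (auto simp: pointwise_def intro: alg_hom_mono)
    moreover have "(g (f' x), g' (f' x)) \<in> ord C"
      using f g x by (auto simp: pointwise_def alg_hom_in)
    ultimately show ?thesis using preordered_algebra_trans[OF preordered[OF C]] by blast
  qed
  then show "(cmp \<V> A B C g f, cmp \<V> A B C g' f') \<in> hle \<V> A C"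
    using f g alg_hom_compose[OF preordered[OF A]] by (auto simp: pointwise_def compose_def)
qed

section \<open>Terms preordered by validity in the variety\<close>

text \<open>The preorder is semantic: validity in all members of the variety, under valuations
  constrained on \<open>X\<close> only. Empty algebras are thus treated correctly: they admit a
  valuation exactly when \<open>X\<close> is empty.\<close>

definition term_algebra :: "'x set \<Rightarrow> ('f, ('f, 'x) tm) alg" where
  "term_algebra X = \<lparr>elems = terms_over \<Sigma> X,
     ord = {(s, t). s \<in> terms_over \<Sigma> X \<and> t \<in> terms_over \<Sigma> X \<and>
       (\<forall>B\<in>obj \<V>. \<forall>\<nu>. \<nu> ` X \<subseteq> elems B \<longrightarrow> (tm_val B \<nu> s, tm_val B \<nu> t) \<in> ord B)},
     opn = Fn\<rparr>"

lemma term_algebra_simps [simp]: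
  "elems (term_algebra X) = terms_over \<Sigma> X"
  "opn (term_algebra X) = Fn"
  by (simp_all add: term_algebra_def)

lemma ord_term_algebra: "(s, t) \<in> ord (term_algebra X) \<longleftrightarrow>
    s \<in> terms_over \<Sigma> X \<and> t \<in> terms_over \<Sigma> X \<and>
    (\<forall>B\<in>obj \<V>. \<forall>\<nu>. \<nu> ` X \<subseteq> elems B \<longrightarrow> (tm_val B \<nu> s, tm_val B \<nu> t) \<in> ord B)"
  by (simp add: term_algebra_def)

lemma preordered_term_algebra: "preordered_algebra \<Sigma> (term_algebra X)"
  unfolding preordered_algebra_def preorder_on_def
proof (intro conjI ballI allI impI)
  show "ord (term_algebra X) \<subseteq> elems (term_algebra X) \<times> elems (term_algebra X)"
    by (auto simp: ord_term_algebra)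
  show "refl_on (elems (term_algebra X)) (ord (term_algebra X))"
    unfolding refl_on_def ord_term_algebra
    by (auto intro!: preordered_algebra_refl[OF preordered] tm_val_in[OF preordered, of _ _ X])
  show "trans (ord (term_algebra X))"
  proof (rule transI)
    fix s t u assume st: "(s, t) \<in> ord (term_algebra X)" and tu: "(t, u) \<in> ord (term_algebra X)"
    have "(tm_val B \<nu> s, tm_val B \<nu> u) \<in> ord B" if B: "B \<in> obj \<V>" and "\<nu> ` X \<subseteq> elems B" for B \<nu>
    proof (rule preordered_algebra_trans[OF preordered[OF B]])
      show "(tm_val B \<nu> s, tm_val B \<nu> t) \<in> ord B" "(tm_val B \<nu> t, tm_val B \<nu> u) \<in> ord B"
        using that st tu unfolding ord_term_algebra by blast+
    qed
    then show "(s, u) \<in> ord (term_algebra X)" using st tu unfolding ord_term_algebra by blast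
  qed
  show "opn (term_algebra X) f ts \<in> elems (term_algebra X)"
    if "f \<in> syms \<Sigma>" "ts \<in> lists (elems (term_algebra X))" "length ts = arity \<Sigma> f" for f ts
    using that by (auto simp: in_lists_conv_set)
  fix f ss ts
  assume f: "f \<in> syms \<Sigma>" "length ss = arity \<Sigma> f"
    and le: "list_all2 (\<lambda>s t. (s, t) \<in> ord (term_algebra X)) ss ts"
  have T: "set ss \<subseteq> terms_over \<Sigma> X \<and> set ts \<subseteq> terms_over \<Sigma> X"
    using le by (induction rule: list_all2_induct) (auto simp: ord_term_algebra)
  have "(tm_val B \<nu> (Fn f ss), tm_val B \<nu> (Fn f ts)) \<in> ord B"
    if B: "B \<in> obj \<V>" and \<nu>: "\<nu> ` X \<subseteq> elems B" for B \<nu>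
  proof -
    have "list_all2 (\<lambda>x y. (x, y) \<in> ord B) (map (tm_val B \<nu>) ss) (map (tm_val B \<nu>) ts)"
      unfolding list_all2_map1 list_all2_map2 using le
      by (rule list_all2_mono) (use B \<nu> in \<open>unfold ord_term_algebra, blast\<close>)
    then show ?thesis using preordered_algebra_mono[OF preordered[OF B] f(1)] f(2) by simp
  qed
  then show "(opn (term_algebra X) f ss, opn (term_algebra X) f ts) \<in> ord (term_algebra X)"
    unfolding ord_term_algebra term_algebra_simps terms_over_Fn
    using T f list_all2_lengthD[OF le] by metis
qed

lemma is_hom_tm_val_term_algebra:
  assumes B: "B \<in> obj \<V>" and \<nu>: "\<nu> ` X \<subseteq> elems B"
  shows "is_hom \<Sigma> (term_algebra X) B (tm_val B \<nu>)"
  unfolding is_hom_def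
proof (intro conjI ballI allI impI)
  show "tm_val B \<nu> ` elems (term_algebra X) \<subseteq> elems B"
    using tm_val_in[OF preordered[OF B] \<nu>] by auto
  show "case z of (s, t) \<Rightarrow> (tm_val B \<nu> s, tm_val B \<nu> t) \<in> ord B" if "z \<in> ord (term_algebra X)" for z
  proof -
    obtain s t where z: "z = (s, t)" by (cases z)
    show ?thesis using that B \<nu> unfolding z ord_term_algebra by blast
  qed
qed simp

text \<open>Substituting terms and then evaluating in \<open>B\<close> is evaluating in
  \<open>B\<close> under another valuation, and \<open>B\<close> satisfies the inequations.\<close>

lemma satisfies_term_algebra: "satisfies (term_algebra (X :: 'x set)) E"
  unfolding satisfies_def
proof (intro ballI, clarify)
  fix s t and \<nu> :: "'v \<Rightarrow> ('f, 'x) tm"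
  assume st: "(s, t) \<in> E" and \<nu>: "range \<nu> \<subseteq> elems (term_algebra X)"
  have T: "s \<in> terms_over \<Sigma> UNIV" "t \<in> terms_over \<Sigma> UNIV"
    using wf st by (auto simp: terms_over_def)
  have "(tm_val B \<mu> (tm_val (term_algebra X) \<nu> s), tm_val B \<mu> (tm_val (term_algebra X) \<nu> t)) \<in> ord B"
    if B: "B \<in> obj \<V>" and \<mu>: "\<mu> ` X \<subseteq> elems B" for B \<mu>
  proof -
    note hom = is_hom_tm_val_term_algebra[OF that]
    have "range (tm_val B \<mu> \<circ> \<nu>) \<subseteq> elems B" using \<nu> is_hom_in[OF hom] by auto
    moreover have "satisfies B E" using B by (simp add: obj_variety)
    ultimately have "(tm_val B (tm_val B \<mu> \<circ> \<nu>) s, tm_val B (tm_val B \<mu> \<circ> \<nu>) t) \<in> ord B"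
      using st unfolding satisfies_def by blast
    then show ?thesis using is_hom_tm_val[OF preordered_term_algebra hom \<nu>] T by simp
  qed
  moreover have "tm_val (term_algebra X) \<nu> s \<in> terms_over \<Sigma> X" "tm_val (term_algebra X) \<nu> t \<in> terms_over \<Sigma> X"
    using tm_val_in[OF preordered_term_algebra \<nu>] T by auto
  ultimately show "(tm_val (term_algebra X) \<nu> s, tm_val (term_algebra X) \<nu> t) \<in> ord (term_algebra X)"
    unfolding ord_term_algebra by blast
qed

text \<open>
  Freeness on a discrete poset, with generators of arbitrary type and without extensionality of
  the unit.
\<close>

definition basis :: "('f, 'u) alg \<Rightarrow> 'x set \<Rightarrow> ('x \<Rightarrow> 'u) \<Rightarrow> bool" where
  "basis A X \<eta> \<longleftrightarrow> A \<in> obj \<V> \<and> \<eta> ` X \<subseteq> elems A \<and>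
     (\<forall>B\<in>obj \<V>.
        (\<forall>\<phi>. \<phi> ` X \<subseteq> elems B \<longrightarrow> (\<exists>h\<in>alg_hom \<Sigma> A B. \<forall>x\<in>X. h (\<eta> x) = \<phi> x)) \<and>
        (\<forall>h\<in>alg_hom \<Sigma> A B. \<forall>k\<in>alg_hom \<Sigma> A B.
           (\<forall>x\<in>X. (h (\<eta> x), k (\<eta> x)) \<in> ord B) \<longrightarrow> (\<forall>a\<in>elems A. (h a, k a) \<in> ord B)))"

lemma
  assumes "basis A X \<eta>"
  shows basis_in: "x \<in> X \<Longrightarrow> \<eta> x \<in> elems A"
    and basis_le: "\<lbrakk>B \<in> obj \<V>; h \<in> alg_hom \<Sigma> A B; k \<in> alg_hom \<Sigma> A B;
      \<And>x. x \<in> X \<Longrightarrow> (h (\<eta> x), k (\<eta> x)) \<in> ord B; a \<in> elems A\<rbrakk> \<Longrightarrow> (h a, k a) \<in> ord B"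
  using assms unfolding basis_def by (simp_all add: image_subset_iff)

lemma basis_extend:
  assumes "basis A X \<eta>" "B \<in> obj \<V>" "\<And>x. x \<in> X \<Longrightarrow> \<phi> x \<in> elems B"
  obtains h where "h \<in> alg_hom \<Sigma> A B" "\<And>x. x \<in> X \<Longrightarrow> h (\<eta> x) = \<phi> x"
  using assms unfolding basis_def by (metis image_subsetI)

text \<open>\<open>basis\<close> contains no uniqueness clause: uniqueness comes from comparing the
  two homomorphisms in both directions, by antisymmetry.\<close>

lemma basis_eq:
  assumes "basis A X \<eta>" and B: "B \<in> obj \<V>" and hk: "h \<in> alg_hom \<Sigma> A B" "k \<in> alg_hom \<Sigma> A B"
    and eq: "\<And>x. x \<in> X \<Longrightarrow> h (\<eta> x) = k (\<eta> x)"
  shows "h = k"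
proof (rule alg_hom_eqI[OF hk])
  fix a assume a: "a \<in> elems A"
  have "(h (\<eta> x), k (\<eta> x)) \<in> ord B" "(k (\<eta> x), h (\<eta> x)) \<in> ord B" if "x \<in> X" for x
    using preordered_algebra_refl[OF preordered[OF B]] alg_hom_in[OF hk(2)] basis_in[OF assms(1) that] eq[OF that]
    by auto
  then have "(h a, k a) \<in> ord B" "(k a, h a) \<in> ord B"
    using basis_le[OF assms(1) B hk _ a] basis_le[OF assms(1) B hk(2,1) _ a] by blast+
  then show "h a = k a" using antisymD[OF antisym_ord[OF B]] by blast
qed

lemma mono_maps_discrete:
  assumes "B \<in> obj \<V>"
  shows "mono_maps X (Id_on X) (elems B) (ord B) = X \<rightarrow>\<^sub>E elems B"
  using preordered_algebra_refl[OF preordered[OF assms]] by (auto simp: mono_maps_def)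

lemma basis_free_on:
  assumes "free_on \<V> A X (Id_on X) \<eta>"
  shows "basis A X \<eta>"
  unfolding basis_def
proof (intro conjI ballI allI impI)
  show A: "A \<in> obj \<V>" using assms by (simp add: free_on_def)
  show \<eta>: "\<eta> ` X \<subseteq> elems A" using assms by (auto simp: free_on_def mono_maps_def)
  fix B assume B: "B \<in> obj \<V>"
  have bij: "bij_betw (\<lambda>h. compose X h \<eta>) (alg_hom \<Sigma> A B) (X \<rightarrow>\<^sub>E elems B)"
    and le: "\<And>h k. h \<in> alg_hom \<Sigma> A B \<Longrightarrow> k \<in> alg_hom \<Sigma> A B \<Longrightarrow>
      (h, k) \<in> hle \<V> A B \<longleftrightarrow> (compose X h \<eta>, compose X k \<eta>) \<in> pointwise X (ord B)"
    using assms B unfolding free_on_def mono_maps_discrete[OF B, symmetric] by simp_all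
  {
    fix \<phi> assume "\<phi> ` X \<subseteq> elems B"
    then have "restrict \<phi> X \<in> X \<rightarrow>\<^sub>E elems B" by auto
    then have "restrict \<phi> X \<in> (\<lambda>h. compose X h \<eta>) ` alg_hom \<Sigma> A B"
      using bij_betw_imp_surj_on[OF bij] by simp
    then obtain h where h: "h \<in> alg_hom \<Sigma> A B" "restrict \<phi> X = compose X h \<eta>" by (rule imageE)
    have "h (\<eta> x) = \<phi> x" if "x \<in> X" for x
      using fun_cong[OF h(2), of x] that by (simp add: compose_def)
    then show "\<exists>h\<in>alg_hom \<Sigma> A B. \<forall>x\<in>X. h (\<eta> x) = \<phi> x" using h(1) by blast
  next
    fix h k a assume "h \<in> alg_hom \<Sigma> A B" "k \<in> alg_hom \<Sigma> A B"
      "\<forall>x\<in>X. (h (\<eta> x), k (\<eta> x)) \<in> ord B" "a \<in> elems A"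
    then show "(h a, k a) \<in> ord B"
      using le[of h k] by (auto simp: pointwise_def compose_def)
  }
qed

text \<open>Bijectivity of restriction along the unit splits into extension of maps and
  \<open>basis_eq\<close>. The unit is cut down to \<open>X\<close> because \<open>mono_maps\<close>
  consists of extensional maps.\<close>

lemma free_on_basis:
  assumes "basis A X \<eta>"
  shows "free_on \<V> A X (Id_on X) (restrict \<eta> X)"
  unfolding free_on_def
proof (intro conjI ballI)
  show A: "A \<in> obj \<V>" using assms by (simp add: basis_def)
  show "restrict \<eta> X \<in> mono_maps X (Id_on X) (elems A) (ord A)"
    unfolding mono_maps_discrete[OF A] using basis_in[OF assms] by auto
  have comp: "compose X h (restrict \<eta> X) = (\<lambda>x\<in>X. h (\<eta> x))" for h by (auto simp: compose_def)
  fix B assume B: "B \<in> obj \<V>"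
  show "bij_betw (\<lambda>h. compose X h (restrict \<eta> X)) (hom \<V> A B)
      (mono_maps X (Id_on X) (elems B) (ord B))"
    unfolding mono_maps_discrete[OF B] variety_simps comp bij_betw_def
  proof (intro conjI subset_antisym)
    show "inj_on (\<lambda>h. \<lambda>x\<in>X. h (\<eta> x)) (alg_hom \<Sigma> A B)"
      by (intro inj_onI basis_eq[OF assms B]) (auto dest: fun_cong split: if_splits simp: fun_eq_iff restrict_def)
    show "(\<lambda>h. \<lambda>x\<in>X. h (\<eta> x)) ` alg_hom \<Sigma> A B \<subseteq> X \<rightarrow>\<^sub>E elems B"
    proof
      fix \<phi> assume "\<phi> \<in> (\<lambda>h. \<lambda>x\<in>X. h (\<eta> x)) ` alg_hom \<Sigma> A B"
      then obtain h where h: "h \<in> alg_hom \<Sigma> A B" "\<phi> = (\<lambda>x\<in>X. h (\<eta> x))" by blast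
      show "\<phi> \<in> X \<rightarrow>\<^sub>E elems B"
        unfolding h(2) using alg_hom_in[OF h(1)] basis_in[OF assms] by simp
    qed
    show "X \<rightarrow>\<^sub>E elems B \<subseteq> (\<lambda>h. \<lambda>x\<in>X. h (\<eta> x)) ` alg_hom \<Sigma> A B"
    proof
      fix \<phi> assume \<phi>: "\<phi> \<in> X \<rightarrow>\<^sub>E elems B"
      then obtain h where h: "h \<in> alg_hom \<Sigma> A B" "\<And>x. x \<in> X \<Longrightarrow> h (\<eta> x) = \<phi> x"
        using basis_extend[OF assms B] by (metis PiE_mem)
      have "\<phi> = (\<lambda>x\<in>X. h (\<eta> x))"
      proof (rule extensionalityI[of _ X])
        show "\<phi> \<in> extensional X" using \<phi> by (simp add: PiE_iff)
      qed (simp_all add: h)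
      then show "\<phi> \<in> (\<lambda>h. \<lambda>x\<in>X. h (\<eta> x)) ` alg_hom \<Sigma> A B"
        using h(1) by (rule image_eqI)
    qed
  qed
  fix h k assume hk: "h \<in> hom \<V> A B" "k \<in> hom \<V> A B"
  then show "(h, k) \<in> hle \<V> A B \<longleftrightarrow>
      (compose X h (restrict \<eta> X), compose X k (restrict \<eta> X)) \<in> pointwise X (ord B)"
    using basis_le[OF assms B] basis_in[OF assms] unfolding comp by (auto simp: pointwise_def)
qed

lemma obj_P_basis:
  assumes "A \<in> obj \<P>"
  obtains X :: "'u set" and \<eta> where "basis A X \<eta>"
proof -
  obtain X \<eta> where "free_on \<V> A X (Id_on X) \<eta>"
    using assms by (auto simp: free_on_discrete_def)
  then show thesis by (rule that[OF basis_free_on])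
qed

text \<open>The free algebra is the collapse of the term algebra, with classes named in a member of
  \<open>U\<close> that is large enough to receive all terms.\<close>

lemma exists_basis:
  fixes X :: "'x set"
  assumes X: "small U X"
  obtains A and \<eta> :: "'x \<Rightarrow> 'u" where "basis A X \<eta>"
proof -
  obtain S where S: "S \<in> U" "terms_over \<Sigma> X \<lesssim> S"
    using small_terms_over[OF universe small_syms X] unfolding small_def by blast
  let ?T = "term_algebra X"
  obtain c where c: "symmetric_kernel ?T c" "c ` elems ?T \<subseteq> S"
    using exists_symmetric_kernel[OF preordered_term_algebra] S(2) by (metis term_algebra_simps(1))
  define A where "A = collapse \<Sigma> c ?T"
  have "c ` elems ?T \<in> U"
    using S(1) c(2) small_in_universe[OF universe] small_subset by metis
  then have A: "A \<in> obj \<V>"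
    unfolding A_def
      by (intro collapse_in_variety preordered_term_algebra c(1) satisfies_term_algebra)
  have c_hom: "is_hom \<Sigma> ?T A c"
    unfolding A_def by (rule is_hom_collapse[OF preordered_term_algebra c(1)])
  \<comment> \<open>Every homomorphism out of \<open>A\<close> is evaluation of terms at its values
    on the generators, so the order clause of \<open>basis\<close> reduces to monotonicity of
    evaluation.\<close>
  have val: "h (c t) = tm_val B (\<lambda>x. h (c (Var x))) t"
    if "h \<in> alg_hom \<Sigma> A B" "t \<in> terms_over \<Sigma> X" for B h t
  proof -
    have "is_hom \<Sigma> ?T B (h \<circ> c)"
      using is_hom_comp[OF c_hom, of B h] that(1) by (simp add: alg_hom_iff)
    moreover have "tm_val ?T Var t = t"
      using that(2) by (induction rule: terms_over_induct) (auto simp: map_idI)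
    moreover have "Var ` X \<subseteq> elems ?T" by auto
    ultimately have "(h \<circ> c) t = tm_val B (h \<circ> c \<circ> Var) t"
      using is_hom_tm_val[OF preordered_term_algebra _ _ that(2)] by metis
    then show ?thesis by (simp add: comp_def)
  qed
  have "basis A X (c \<circ> Var)"
    unfolding basis_def
  proof (intro conjI ballI allI impI)
    show "(c \<circ> Var) ` X \<subseteq> elems A" by (auto simp: A_def)
    fix B assume B: "B \<in> obj \<V>"
    {
      fix \<phi> assume \<phi>: "\<phi> ` X \<subseteq> elems B"
      obtain h where "h \<in> alg_hom \<Sigma> A B" "\<And>t. t \<in> elems ?T \<Longrightarrow> h (c t) = tm_val B \<phi> t"
        using collapse_factor[OF preordered_term_algebra c(1) is_hom_tm_val_term_algebra[OF B \<phi>] antisym_ord[OF B]]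
        unfolding A_def by blast
      then show "\<exists>h\<in>alg_hom \<Sigma> A B. \<forall>x\<in>X. h ((c \<circ> Var) x) = \<phi> x" by (intro bexI[of _ h]) auto
    next
      fix h k a assume h: "h \<in> alg_hom \<Sigma> A B" and k: "k \<in> alg_hom \<Sigma> A B"
        and le: "\<forall>x\<in>X. (h ((c \<circ> Var) x), k ((c \<circ> Var) x)) \<in> ord B" and "a \<in> elems A"
      then obtain t where t: "a = c t" "t \<in> terms_over \<Sigma> X" by (auto simp: A_def)
      have "(tm_val B (\<lambda>x. h (c (Var x))) t, tm_val B (\<lambda>x. k (c (Var x))) t) \<in> ord B"
        by (rule tm_val_mono[OF preordered[OF B] _ t(2)]) (use le in simp)
      then show "(h a, k a) \<in> ord B"
        unfolding t(1) val[OF h t(2)] val[OF k t(2)] .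
    }
  qed (rule A)
  then show thesis by (rule that)
qed

lemma basis_reindex:
  assumes "basis A X \<eta>" "bij_betw j Y X"
  shows "basis A Y (\<eta> \<circ> j)"
  unfolding basis_def
proof (intro conjI ballI allI impI)
  show "A \<in> obj \<V>" using assms(1) by (simp add: basis_def)
  have jY: "j ` Y = X" using assms(2) by (rule bij_betw_imp_surj_on)
  then show "(\<eta> \<circ> j) ` Y \<subseteq> elems A" using basis_in[OF assms(1)] by auto
  fix B assume B: "B \<in> obj \<V>"
  {
    fix \<phi> assume \<phi>: "\<phi> ` Y \<subseteq> elems B"
    then have "\<phi> (inv_into Y j x) \<in> elems B" if "x \<in> X" for x
      using that jY by (auto simp: inv_into_into)
    then obtain h where "h \<in> alg_hom \<Sigma> A B" "\<And>x. x \<in> X \<Longrightarrow> h (\<eta> x) = \<phi> (inv_into Y j x)"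
      using basis_extend[OF assms(1) B, of "\<lambda>x. \<phi> (inv_into Y j x)"] by blast
    then show "\<exists>h\<in>alg_hom \<Sigma> A B. \<forall>y\<in>Y. h ((\<eta> \<circ> j) y) = \<phi> y"
      using jY bij_betw_inv_into_left[OF assms(2)] by (intro bexI[of _ h]) auto
  next
    fix h k a assume hk: "h \<in> alg_hom \<Sigma> A B" "k \<in> alg_hom \<Sigma> A B"
      and le: "\<forall>y\<in>Y. (h ((\<eta> \<circ> j) y), k ((\<eta> \<circ> j) y)) \<in> ord B" and a: "a \<in> elems A"
    show "(h a, k a) \<in> ord B"
      by (rule basis_le[OF assms(1) B hk _ a]) (use le jY in auto)
  }
qed

text \<open>Objects of \<open>\<P>\<close> have generators forming a member of \<open>U\<close>, but
  the generating sets that occur below include sets of pairs and a set of type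
  \<open>unit set\<close>. They are copied along an injection and the basis is reindexed.\<close>

lemma exists_free:
  fixes X :: "'x set"
  assumes "small U X"
  obtains A and \<eta> :: "'x \<Rightarrow> 'u" where "A \<in> obj \<P>" "basis A X \<eta>"
proof -
  obtain S i where S: "S \<in> U" and i: "inj_on i X" "i ` X \<subseteq> S"
    using assms unfolding small_def lepoll_def by blast
  let ?X = "i ` X"
  have X: "?X \<in> U" using S i(2) small_in_universe[OF universe] small_subset by metis
  then obtain A \<eta> where A: "basis A ?X \<eta>"
    using exists_basis small_in_universe[OF universe] by metis
  then have "A \<in> obj \<P>"
    using free_on_basis[OF A] X by (auto simp: free_on_discrete_def free_on_def)
  moreover have "basis A X (\<eta> \<circ> i)" 
    by (rule basis_reindex[OF A]) (use i(1) in \<open>simp add: bij_betw_def\<close>)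
  ultimately show thesis by (rule that)
qed

end

section \<open>The comparison functor\<close>

lemma ex_cat_simps:
  "obj (ex_cat C) = {K. pseudocongruence C K}"
  "hom (ex_cat C) K L = ex_arr C K L // ex_eq C K L"
  "hle (ex_cat C) K L = {(ex_class C K L f, ex_class C K L g) | f g. (f, g) \<in> ex_pre C K L}"
  "cmp (ex_cat C) K L M G F =
    (\<Union>f\<in>F. \<Union>g\<in>G. ex_class C K M (cmp C (base K) (base L) (base M) g f))"
  "idn (ex_cat C) K = ex_class C K K (idn C (base K))"
  by (simp_all add: ex_cat_def)

text \<open>The relation rho. The legs need not be jointly injective, but arrows and their preorder
  turn out to depend on \<open>rel K\<close> only through this image.\<close>

definition leg_rel :: "(('f, 'u) alg, 'u \<Rightarrow> 'u) ppair \<Rightarrow> ('u \<times> 'u) set" where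
  "leg_rel K = (\<lambda>z. (leg0 K z, leg1 K z)) ` elems (rel K)"

definition preordered_base :: "(('f, 'u) alg, 'u \<Rightarrow> 'u) ppair \<Rightarrow> ('f, 'u) alg" where
  "preordered_base K = (base K)\<lparr>ord := leg_rel K\<rparr>"

lemma preordered_base_simps [simp]:
  "elems (preordered_base K) = elems (base K)"
  "ord (preordered_base K) = leg_rel K"
  "opn (preordered_base K) = opn (base K)"
  by (simp_all add: preordered_base_def)

text \<open>A fixed choice of names for the classes. Taking the names from the base itself makes the
  quotient small.\<close>

definition quot_map :: "(('f, 'u) alg, 'u \<Rightarrow> 'u) ppair \<Rightarrow> 'u \<Rightarrow> 'u" where
  "quot_map K = (SOME c. symmetric_kernel (preordered_base K) c \<and> c ` elems (base K) \<subseteq> elems (base K))"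

definition quot :: "'f signature \<Rightarrow> (('f, 'u) alg, 'u \<Rightarrow> 'u) ppair \<Rightarrow> ('f, 'u) alg" where
  "quot \<Sigma> K = collapse \<Sigma> (quot_map K) (preordered_base K)"

lemma elems_quot: "elems (quot \<Sigma> K) = quot_map K ` elems (base K)"
  by (simp add: quot_def)

context ordered_variety
begin

text \<open>The projectivity of the algebras free on a discrete poset.\<close>

lemma lift_pair:
  assumes A: "A \<in> obj \<P>" and W: "W \<in> obj \<V>" and Y: "Y \<in> obj \<V>" and Z: "Z \<in> obj \<V>"
    and d: "d0 \<in> alg_hom \<Sigma> W Y" "d1 \<in> alg_hom \<Sigma> W Z"
    and a: "a0 \<in> alg_hom \<Sigma> A Y" "a1 \<in> alg_hom \<Sigma> A Z"
    and ex: "\<And>a. a \<in> elems A \<Longrightarrow> \<exists>w\<in>elems W. d0 w = a0 a \<and> d1 w = a1 a"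
  obtains u where "u \<in> alg_hom \<Sigma> A W" "compose (elems A) d0 u = a0" "compose (elems A) d1 u = a1"
proof -
  obtain X :: "'u set" and \<eta> where X: "basis A X \<eta>" using obj_P_basis[OF A] .
  \<comment> \<open>Only generators are lifted, by choice. Both triangles then commute everywhere
    because homomorphisms out of a free algebra agree once they agree on the basis.\<close>
  have "\<forall>x\<in>X. \<exists>w. w \<in> elems W \<and> d0 w = a0 (\<eta> x) \<and> d1 w = a1 (\<eta> x)"
    using ex basis_in[OF X] by blast
  from bchoice[OF this] obtain \<phi> where \<phi>: "\<And>x. x \<in> X \<Longrightarrow> \<phi> x \<in> elems W"
    "\<And>x. x \<in> X \<Longrightarrow> d0 (\<phi> x) = a0 (\<eta> x)" "\<And>x. x \<in> X \<Longrightarrow> d1 (\<phi> x) = a1 (\<eta> x)"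
    by blast
  obtain u where u: "u \<in> alg_hom \<Sigma> A W" "\<And>x. x \<in> X \<Longrightarrow> u (\<eta> x) = \<phi> x"
    using basis_extend[OF X W, of \<phi>] \<phi>(1) by blast
  note comp = alg_hom_compose[OF preordered[OF P_V[OF A]] u(1)]
  have "compose (elems A) d0 u = a0"
    using \<phi>(2) u(2) basis_in[OF X]
      by (intro basis_eq[OF X Y comp[OF d(1)] a(1)]) (simp add: compose_def)
  moreover have "compose (elems A) d1 u = a1"
    using \<phi>(3) u(2) basis_in[OF X]
      by (intro basis_eq[OF X Z comp[OF d(2)] a(2)]) (simp add: compose_def)
  ultimately show thesis using that[OF u(1)] by blast
qed

section \<open>Pseudocongruences of free algebras as preorders on the base\<close>

text \<open>Homomorphisms out of this algebra amount to elements of the target, so it turns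
  statements about arrows of \<open>\<P>\<close> into statements about elements.\<close>

lemma exists_free_point:
  obtains A g where "A \<in> obj \<P>" "basis A {()} (\<lambda>_. g)"
proof -
  obtain S where "S \<in> U" "infinite S" using universe unfolding size_universe_def by blast
  then have "small U {()}" unfolding small_def
    by (meson finite.emptyI finite.insertI finite_lepoll_infinite)
  then obtain A and \<eta> :: "unit \<Rightarrow> 'u" where A: "A \<in> obj \<P>" "basis A {()} \<eta>" by (rule exists_free)
  moreover have "\<eta> = (\<lambda>_. \<eta> ())" by (simp add: fun_eq_iff)
  ultimately show thesis using that by metis
qed

lemma
  assumes "pseudocongruence \<P> K"
  shows pseudocongruence_base: "base K \<in> obj \<P>"
    and pseudocongruence_rel: "rel K \<in> obj \<P>"
    and pseudocongruence_legs: "leg0 K \<in> alg_hom \<Sigma> (rel K) (base K)"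
      "leg1 K \<in> alg_hom \<Sigma> (rel K) (base K)"
    and leg_rel_reflexive: "ord (base K) \<subseteq> leg_rel K"
    and leg_rel_trans: "trans (leg_rel K)"
proof -
  let ?X = "base K" and ?R = "rel K" and ?r0 = "leg0 K" and ?r1 = "leg1 K"
  show X: "?X \<in> obj \<P>" and R: "?R \<in> obj \<P>"
    and r: "?r0 \<in> alg_hom \<Sigma> ?R ?X" "?r1 \<in> alg_hom \<Sigma> ?R ?X"
    using assms unfolding pseudocongruence_def Let_def full_sub_simps variety_simps by blast+
  have refl: "\<exists>u\<in>alg_hom \<Sigma> A ?R. compose (elems A) ?r0 u = a0 \<and> compose (elems A) ?r1 u = a1"
    if "A \<in> obj \<P>" "(a0, a1) \<in> hle \<V> A ?X" for A a0 a1
    using assms that unfolding pseudocongruence_def Let_def full_sub_simps variety_simps by blast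
  obtain P d0 d1 \<tau> where wp: "weak_pullback \<P> ?R ?R ?X ?r1 ?r0 P d0 d1"
    and \<tau>: "\<tau> \<in> alg_hom \<Sigma> P ?R" "compose (elems P) ?r0 \<tau> = compose (elems P) ?r0 d0"
      "compose (elems P) ?r1 \<tau> = compose (elems P) ?r1 d1"
    using assms unfolding pseudocongruence_def Let_def full_sub_simps variety_simps by blast
  obtain A g where A: "A \<in> obj \<P>" and g: "basis A {()} (\<lambda>_. g)" by (rule exists_free_point)
  have gA: "g \<in> elems A" using basis_in[OF g] by simp
  show "ord ?X \<subseteq> leg_rel K"
  proof clarify
    fix x y assume xy: "(x, y) \<in> ord ?X"
    then have "x \<in> elems ?X" "y \<in> elems ?X"
      using preordered_algebra_dom[OF preordered[OF P_V[OF X]]] by blast+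
    then obtain a0 a1 where a: "a0 \<in> alg_hom \<Sigma> A ?X" "a0 g = x" "a1 \<in> alg_hom \<Sigma> A ?X" "a1 g = y"
      using basis_extend[OF g P_V[OF X], of "\<lambda>_. x"] basis_extend[OF g P_V[OF X], of "\<lambda>_. y"]
      by (metis insertI1)
    \<comment> \<open>Condition (1) wants an inequality between homomorphisms; on a free algebra it
      may be checked at the generator.\<close>
    have "(a0 z, a1 z) \<in> ord ?X" if "z \<in> elems A" for z
      by (rule basis_le[OF g P_V[OF X] a(1,3) _ that]) (simp add: a xy)
    then have "(a0, a1) \<in> hle \<V> A ?X" using a by (simp add: pointwise_def)
    then obtain u where u: "u \<in> alg_hom \<Sigma> A ?R"
      "compose (elems A) ?r0 u = a0" "compose (elems A) ?r1 u = a1"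
      using refl[OF A] by blast
    have "x = ?r0 (u g)" "y = ?r1 (u g)"
      using fun_cong[OF u(2), of g] fun_cong[OF u(3), of g] a gA by (simp_all add: compose_def)
    moreover have "u g \<in> elems ?R" using alg_hom_in[OF u(1) gA] .
    ultimately show "(x, y) \<in> leg_rel K" unfolding leg_rel_def
      by (intro image_eqI[of _ _ "u g"]) simp_all
  qed
  show "trans (leg_rel K)"
  proof (rule transI)
    fix x y z assume "(x, y) \<in> leg_rel K" "(y, z) \<in> leg_rel K"
    then obtain p q where pq: "p \<in> elems ?R" "x = ?r0 p" "y = ?r1 p" "q \<in> elems ?R" "y = ?r0 q" "z = ?r1 q"
      unfolding leg_rel_def by blast
    obtain e0 where e0: "e0 \<in> alg_hom \<Sigma> A ?R" "e0 g = p"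
      using basis_extend[OF g P_V[OF R], of "\<lambda>_. p"] pq(1) by blast
    obtain e1 where e1: "e1 \<in> alg_hom \<Sigma> A ?R" "e1 g = q"
      using basis_extend[OF g P_V[OF R], of "\<lambda>_. q"] pq(4) by blast
    note comp = alg_hom_compose[OF preordered[OF P_V[OF A]]]
    \<comment> \<open>\<open>e0\<close> and \<open>e1\<close> name \<open>p\<close> and
      \<open>q\<close>, so they form a cone over the cospan. Its factorization \<open>u\<close>
      sends \<open>g\<close> to a point of \<open>P\<close> above \<open>p\<close> and
      \<open>q\<close>, and \<tau> maps that point to a witness for the pair of \<open>x\<close> and
      \<open>z\<close>.\<close>
    have "compose (elems A) ?r1 e0 = compose (elems A) ?r0 e1"
      using e0(2) e1(2) pq gA
      by (intro basis_eq[OF g P_V[OF X] comp[OF e0(1) r(2)] comp[OF e1(1) r(1)]]) (simp add: compose_def)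
    then obtain u where u: "u \<in> alg_hom \<Sigma> A P" "compose (elems A) d0 u = e0" "compose (elems A) d1 u = e1"
      using wp A e0(1) e1(1) unfolding weak_pullback_def full_sub_simps(2-) variety_simps by blast
    have ug: "u g \<in> elems P" "d0 (u g) = p" "d1 (u g) = q"
      using alg_hom_in[OF u(1) gA] fun_cong[OF u(2), of g] fun_cong[OF u(3), of g] e0(2) e1(2) gA
      by (simp_all add: compose_def)
    have "x = ?r0 (\<tau> (u g))" "z = ?r1 (\<tau> (u g))"
      using fun_cong[OF \<tau>(2), of "u g"] fun_cong[OF \<tau>(3), of "u g"] ug pq
        by (simp_all add: compose_def)
    moreover have "\<tau> (u g) \<in> elems ?R" using alg_hom_in[OF \<tau>(1) ug(1)] .
    ultimately show "(x, z) \<in> leg_rel K"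
      unfolding leg_rel_def by (intro image_eqI[of _ _ "\<tau> (u g)"]) simp_all
  qed
qed

text \<open>The single source of arrows into \<open>rel K\<close>: condition (1), \<tau>, f-bar and
  Sigma are all obtained here from pointwise membership in \<open>leg_rel K\<close>. The hypotheses
  stop short of \<open>pseudocongruence\<close>, so that the lemma can serve to establish
  it.\<close>

lemma leg_rel_lift:
  assumes "base K \<in> obj \<V>" "rel K \<in> obj \<V>"
    and "leg0 K \<in> alg_hom \<Sigma> (rel K) (base K)" "leg1 K \<in> alg_hom \<Sigma> (rel K) (base K)"
    and "A \<in> obj \<P>" "a0 \<in> alg_hom \<Sigma> A (base K)" "a1 \<in> alg_hom \<Sigma> A (base K)"
    and "\<And>a. a \<in> elems A \<Longrightarrow> (a0 a, a1 a) \<in> leg_rel K"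
  shows "\<exists>u\<in>alg_hom \<Sigma> A (rel K). compose (elems A) (leg0 K) u = a0 \<and> compose (elems A) (leg1 K) u = a1"
proof -
  have "\<exists>w\<in>elems (rel K). leg0 K w = a0 a \<and> leg1 K w = a1 a" if "a \<in> elems A" for a
    using assms(8)[OF that] unfolding leg_rel_def by auto
  then obtain u where "u \<in> alg_hom \<Sigma> A (rel K)"
    "compose (elems A) (leg0 K) u = a0" "compose (elems A) (leg1 K) u = a1"
    by (rule lift_pair[OF assms(5,2,1,1,3,4,6,7)])
  then show ?thesis by blast
qed

lemma pseudocongruenceI:
  assumes X: "base K \<in> obj \<P>" and R: "rel K \<in> obj \<P>"
    and r: "leg0 K \<in> alg_hom \<Sigma> (rel K) (base K)" "leg1 K \<in> alg_hom \<Sigma> (rel K) (base K)"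
    and refl: "ord (base K) \<subseteq> leg_rel K" and tr: "trans (leg_rel K)"
  shows "pseudocongruence \<P> K"
proof -
  let ?X = "base K" and ?R = "rel K" and ?r0 = "leg0 K" and ?r1 = "leg1 K"
  note lift = leg_rel_lift[OF P_V[OF X] P_V[OF R] r]
  have 1: "\<exists>u\<in>alg_hom \<Sigma> A ?R. compose (elems A) ?r0 u = a0 \<and> compose (elems A) ?r1 u = a1"
    if A: "A \<in> obj \<P>" and a: "(a0, a1) \<in> hle \<V> A ?X" for A a0 a1
  proof (rule lift[OF A])
    show "a0 \<in> alg_hom \<Sigma> A ?X" "a1 \<in> alg_hom \<Sigma> A ?X" using a by auto
    show "(a0 z, a1 z) \<in> leg_rel K" if "z \<in> elems A" for z
      using a that refl by (auto simp: pointwise_def)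
  qed
  \<comment> \<open>The pullback of the carriers. As an algebra it need not be free, so the free
    algebra \<open>P\<close> on its elements replaces it; \<open>P\<close> has a point above every
    element of \<open>D\<close>, and by projectivity this is enough for a weak pullback in
    \<open>\<P>\<close>.\<close>
  define D where "D = {(z, w). z \<in> elems ?R \<and> w \<in> elems ?R \<and> ?r1 z = ?r0 w}"
  have "small U (elems ?R \<times> elems ?R)"
    using small_Times[OF universe] small_elems[OF P_V[OF R]] by blast
  then have "small U D" by (rule small_subset) (auto simp: D_def)
  then obtain P and \<eta> :: "'u \<times> 'u \<Rightarrow> 'u" where P: "P \<in> obj \<P>" and \<eta>: "basis P D \<eta>"
    by (rule exists_free)
  obtain d0 where d0: "d0 \<in> alg_hom \<Sigma> P ?R" "\<And>p. p \<in> D \<Longrightarrow> d0 (\<eta> p) = fst p"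
    by (rule basis_extend[OF \<eta> P_V[OF R], of fst]) (auto simp: D_def)
  obtain d1 where d1: "d1 \<in> alg_hom \<Sigma> P ?R" "\<And>p. p \<in> D \<Longrightarrow> d1 (\<eta> p) = snd p"
    by (rule basis_extend[OF \<eta> P_V[OF R], of snd]) (auto simp: D_def)
  note comp = alg_hom_compose[OF preordered[OF P_V[OF P]]]
  have eq: "compose (elems P) ?r1 d0 = compose (elems P) ?r0 d1"
  proof (rule basis_eq[OF \<eta> P_V[OF X] comp[OF d0(1) r(2)] comp[OF d1(1) r(1)]])
    fix p assume "p \<in> D"
    then show "compose (elems P) ?r1 d0 (\<eta> p) = compose (elems P) ?r0 d1 (\<eta> p)"
      using d0(2) d1(2) basis_in[OF \<eta>] by (auto simp: compose_def D_def)
  qed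
  have "\<exists>u\<in>alg_hom \<Sigma> A P. compose (elems A) d0 u = e0 \<and> compose (elems A) d1 u = e1"
    if A: "A \<in> obj \<P>" and e: "e0 \<in> alg_hom \<Sigma> A ?R" "e1 \<in> alg_hom \<Sigma> A ?R"
      and eq: "compose (elems A) ?r1 e0 = compose (elems A) ?r0 e1" for A e0 e1
  proof -
    have "\<exists>w\<in>elems P. d0 w = e0 a \<and> d1 w = e1 a" if a: "a \<in> elems A" for a
    proof -
      have "(e0 a, e1 a) \<in> D"
        using fun_cong[OF eq, of a] a alg_hom_in[OF e(1) a] alg_hom_in[OF e(2) a]
        by (simp add: D_def compose_def)
      then show ?thesis using basis_in[OF \<eta>] d0(2) d1(2)
        by (intro bexI[of _ "\<eta> (e0 a, e1 a)"]) simp_all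
    qed
    then obtain u where "u \<in> alg_hom \<Sigma> A P" "compose (elems A) d0 u = e0" "compose (elems A) d1 u = e1"
      by (rule lift_pair[OF A P_V[OF P] P_V[OF R] P_V[OF R] d0(1) d1(1) e])
    then show ?thesis by blast
  qed
  then have wp: "weak_pullback \<P> ?R ?R ?X ?r1 ?r0 P d0 d1"
    unfolding weak_pullback_def full_sub_simps(2-) variety_simps using P d0(1) d1(1) eq by blast
  have 2: "\<exists>\<tau>\<in>alg_hom \<Sigma> P ?R. compose (elems P) ?r0 \<tau> = compose (elems P) ?r0 d0 \<and>
      compose (elems P) ?r1 \<tau> = compose (elems P) ?r1 d1"
  proof (rule lift[OF P comp[OF d0(1) r(1)] comp[OF d1(1) r(2)]])
    fix p assume p: "p \<in> elems P"
    have "(?r0 (d0 p), ?r1 (d0 p)) \<in> leg_rel K" "(?r0 (d1 p), ?r1 (d1 p)) \<in> leg_rel K"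
      unfolding leg_rel_def using alg_hom_in[OF d0(1) p] alg_hom_in[OF d1(1) p] by blast+
    \<comment> \<open>The two pairs are composable at every \<open>p\<close>, not only at
      generators, since \<open>eq\<close> is an equation of homomorphisms.\<close>
    moreover have "?r1 (d0 p) = ?r0 (d1 p)" using fun_cong[OF eq, of p] p by (simp add: compose_def)
    ultimately show "(compose (elems P) ?r0 d0 p, compose (elems P) ?r1 d1 p) \<in> leg_rel K"
      using p transD[OF tr, of "?r0 (d0 p)" "?r1 (d0 p)" "?r1 (d1 p)"] by (simp add: compose_def)
  qed
  show ?thesis
    unfolding pseudocongruence_def Let_def full_sub_simps(2-) variety_simps
    using X R r 1 2 wp unfolding variety_simps by blast
qed

section \<open>The quotient algebra of a pseudocongruence\<close>

lemma preordered_algebra_base: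
  assumes K: "pseudocongruence \<P> K"
  shows "preordered_algebra \<Sigma> (preordered_base K)"
proof -
  note X = P_V[OF pseudocongruence_base[OF K]] and R = P_V[OF pseudocongruence_rel[OF K]]
    and r = pseudocongruence_legs[OF K]
  show ?thesis
    unfolding preordered_algebra_def preorder_on_def preordered_base_simps
  proof (intro conjI ballI allI impI)
    show "leg_rel K \<subseteq> elems (base K) \<times> elems (base K)"
      using alg_hom_in[OF r(1)] alg_hom_in[OF r(2)] by (auto simp: leg_rel_def)
    show "refl_on (elems (base K)) (leg_rel K)"
      using leg_rel_reflexive[OF K] preordered_algebra_refl[OF preordered[OF X]]
        by (auto simp: refl_on_def)
    show "trans (leg_rel K)" by (rule leg_rel_trans[OF K])
    show "opn (base K) f xs \<in> elems (base K)"
      if "f \<in> syms \<Sigma>" "xs \<in> lists (elems (base K))" "length xs = arity \<Sigma> f" for f xs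
      using preordered_algebra_opn[OF preordered[OF X] that(1) _ that(3)] that(2)
        by (simp add: in_lists_conv_set subset_iff)
    fix f xs ys assume f: "f \<in> syms \<Sigma>" "length xs = arity \<Sigma> f"
      and le: "list_all2 (\<lambda>x y. (x, y) \<in> leg_rel K) xs ys"
    \<comment> \<open>Related argument lists come from one list in \<open>rel K\<close>; the
      operation is applied there and both legs carry the result down.\<close>
    have "\<exists>zs. set zs \<subseteq> elems (rel K) \<and> xs = map (leg0 K) zs \<and> ys = map (leg1 K) zs"
      using le
    proof (induction rule: list_all2_induct)
      case (Cons x xs y ys)
      then obtain z zs where "z \<in> elems (rel K)" "x = leg0 K z" "y = leg1 K z"
        "set zs \<subseteq> elems (rel K)" "xs = map (leg0 K) zs" "ys = map (leg1 K) zs"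
        unfolding leg_rel_def by blast
      then show ?case by (intro exI[of _ "z # zs"]) simp
    qed simp
    then obtain zs where zs: "set zs \<subseteq> elems (rel K)" "xs = map (leg0 K) zs" "ys = map (leg1 K) zs"
      by blast
    then have len: "length zs = arity \<Sigma> f" using f(2) by simp
    have "opn (rel K) f zs \<in> elems (rel K)"
      by (rule preordered_algebra_opn[OF preordered[OF R] f(1) zs(1) len])
    then show "(opn (base K) f xs, opn (base K) f ys) \<in> leg_rel K"
      unfolding leg_rel_def zs alg_hom_opn[OF r(1) f(1) zs(1) len, symmetric]
        alg_hom_opn[OF r(2) f(1) zs(1) len, symmetric]
      by (rule imageI)
  qed
qed

lemma quot_map:
  assumes K: "pseudocongruence \<P> K"
  shows "symmetric_kernel (preordered_base K) (quot_map K)"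
    and "quot_map K ` elems (base K) \<subseteq> elems (base K)"
proof -
  obtain c where "symmetric_kernel (preordered_base K) c" "c ` elems (preordered_base K) \<subseteq> elems (base K)"
    by (rule exists_symmetric_kernel[OF preordered_algebra_base[OF K], of "elems (base K)"])
      (simp add: lepoll_refl)
  then have "symmetric_kernel (preordered_base K) c \<and> c ` elems (base K) \<subseteq> elems (base K)" by simp
  from someI[of "\<lambda>c. symmetric_kernel (preordered_base K) c \<and> c ` elems (base K) \<subseteq> elems (base K)", OF this]
  show "symmetric_kernel (preordered_base K) (quot_map K)"
    "quot_map K ` elems (base K) \<subseteq> elems (base K)"
    unfolding quot_map_def by blast+
qed

lemma ord_quot_iff:
  assumes "pseudocongruence \<P> K" "x \<in> elems (base K)" "y \<in> elems (base K)"
  shows "(quot_map K x, quot_map K y) \<in> ord (quot \<Sigma> K) \<longleftrightarrow> (x, y) \<in> leg_rel K"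
  unfolding quot_def
  using ord_collapse_iff[OF preordered_algebra_base quot_map(1), OF assms(1,1)] assms(2,3) by simp

lemma quot_map_eq_iff:
  assumes "pseudocongruence \<P> K" "x \<in> elems (base K)" "y \<in> elems (base K)"
  shows "quot_map K x = quot_map K y \<longleftrightarrow> (x, y) \<in> leg_rel K \<and> (y, x) \<in> leg_rel K"
  using quot_map(1)[OF assms(1)] assms(2,3) unfolding symmetric_kernel_def by simp

lemma quot_in_variety:
  assumes K: "pseudocongruence \<P> K"
  shows "quot \<Sigma> K \<in> obj \<V>"
  unfolding quot_def
proof (rule collapse_in_variety[OF preordered_algebra_base[OF K] quot_map(1)[OF K]])
  note X = P_V[OF pseudocongruence_base[OF K]]
  \<comment> \<open>Evaluation sees only the operations, which are unchanged, and enlarging the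
    order preserves validity of inequations.\<close>
  have "tm_val (preordered_base K) \<nu> t = tm_val (base K) \<nu> t" for \<nu> and t :: "('f, 'v) tm"
    by (induction t) (simp_all cong: map_cong)
  moreover have "satisfies (base K) E" using X by (simp add: obj_variety)
  ultimately show "satisfies (preordered_base K) E"
    using leg_rel_reflexive[OF K] unfolding satisfies_def by fastforce
  show "quot_map K ` elems (preordered_base K) \<in> U"
    using small_subset[OF small_elems[OF X] quot_map(2)[OF K]] small_in_universe[OF universe] by simp
qed

lemma quot_hom: "pseudocongruence \<P> K \<Longrightarrow> is_hom \<Sigma> (preordered_base K) (quot \<Sigma> K) (quot_map K)"
  unfolding quot_def by (intro is_hom_collapse preordered_algebra_base quot_map)

lemma quot_hom_eqI:
  assumes "h \<in> alg_hom \<Sigma> (quot \<Sigma> K) B" "k \<in> alg_hom \<Sigma> (quot \<Sigma> K) C"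
    and "\<And>x. x \<in> elems (base K) \<Longrightarrow> h (quot_map K x) = k (quot_map K x)"
  shows "h = k"
  using assms(3) by (intro alg_hom_eqI[OF assms(1,2)]) (auto simp: elems_quot)

section \<open>Arrows of \<open>P_ex\<close> and their preorder, read pointwise\<close>

text \<open>An f-bar evaluated at a witness gives preservation of the relation. Conversely,
  \<open>f\<close> after the two legs of \<open>K\<close> lands in \<open>leg_rel L\<close>, and
  \<open>rel K\<close> is free, so this pair lifts to \<open>rel L\<close>.\<close>

lemma ex_arr_iff:
  assumes K: "pseudocongruence \<P> K" and L: "pseudocongruence \<P> L"
  shows "f \<in> ex_arr \<P> K L \<longleftrightarrow> f \<in> alg_hom \<Sigma> (base K) (base L) \<and>
    (\<forall>x y. (x, y) \<in> leg_rel K \<longrightarrow> (f x, f y) \<in> leg_rel L)"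
proof (intro iffI conjI allI impI)
  assume f: "f \<in> ex_arr \<P> K L"
  then show "f \<in> alg_hom \<Sigma> (base K) (base L)" by (simp add: ex_arr_def)
  obtain h where h: "h \<in> alg_hom \<Sigma> (rel K) (rel L)"
    "compose (elems (rel K)) (leg0 L) h = compose (elems (rel K)) f (leg0 K)"
    "compose (elems (rel K)) (leg1 L) h = compose (elems (rel K)) f (leg1 K)"
    using f by (auto simp: ex_arr_def)
  fix x y assume "(x, y) \<in> leg_rel K"
  then obtain z where z: "z \<in> elems (rel K)" "x = leg0 K z" "y = leg1 K z"
    by (auto simp: leg_rel_def)
  then have "f x = leg0 L (h z)" "f y = leg1 L (h z)"
    using fun_cong[OF h(2), of z] fun_cong[OF h(3), of z] by (simp_all add: compose_def)
  then show "(f x, f y) \<in> leg_rel L" unfolding leg_rel_def using alg_hom_in[OF h(1) z(1)] by simp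
next
  assume f: "f \<in> alg_hom \<Sigma> (base K) (base L) \<and> (\<forall>x y. (x, y) \<in> leg_rel K \<longrightarrow> (f x, f y) \<in> leg_rel L)"
  note R = pseudocongruence_rel[OF K] and r = pseudocongruence_legs[OF K]
  note comp = alg_hom_compose[OF preordered[OF P_V[OF R]]]
  have "\<exists>h\<in>alg_hom \<Sigma> (rel K) (rel L).
    compose (elems (rel K)) (leg0 L) h = compose (elems (rel K)) f (leg0 K) \<and>
    compose (elems (rel K)) (leg1 L) h = compose (elems (rel K)) f (leg1 K)"
  proof (rule leg_rel_lift[OF P_V[OF pseudocongruence_base[OF L]] P_V[OF pseudocongruence_rel[OF L]]
        pseudocongruence_legs[OF L] R])
    show "compose (elems (rel K)) f (leg0 K) \<in> alg_hom \<Sigma> (rel K) (base L)"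
      "compose (elems (rel K)) f (leg1 K) \<in> alg_hom \<Sigma> (rel K) (base L)"
      using comp[OF r(1)] comp[OF r(2)] f by blast+
    show "(compose (elems (rel K)) f (leg0 K) a, compose (elems (rel K)) f (leg1 K) a) \<in> leg_rel L"
      if "a \<in> elems (rel K)" for a
      using f that by (simp add: compose_def leg_rel_def)
  qed
  then show "f \<in> ex_arr \<P> K L" using f by (simp add: ex_arr_def)
qed

text \<open>The same lifting argument, this time with the free algebra \<open>base K\<close> as
  domain.\<close>

lemma ex_pre_iff:
  assumes K: "pseudocongruence \<P> K" and L: "pseudocongruence \<P> L"
  shows "(f, g) \<in> ex_pre \<P> K L \<longleftrightarrow> f \<in> ex_arr \<P> K L \<and> g \<in> ex_arr \<P> K L \<and>
    (\<forall>x\<in>elems (base K). (f x, g x) \<in> leg_rel L)"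
proof -
  have "(\<exists>s\<in>alg_hom \<Sigma> (base K) (rel L). compose (elems (base K)) (leg0 L) s = f \<and>
      compose (elems (base K)) (leg1 L) s = g) \<longleftrightarrow> (\<forall>x\<in>elems (base K). (f x, g x) \<in> leg_rel L)"
    if f: "f \<in> ex_arr \<P> K L" and g: "g \<in> ex_arr \<P> K L"
  proof (intro iffI ballI)
    fix x assume "\<exists>s\<in>alg_hom \<Sigma> (base K) (rel L). compose (elems (base K)) (leg0 L) s = f \<and>
      compose (elems (base K)) (leg1 L) s = g" and x: "x \<in> elems (base K)"
    then obtain s where s: "s \<in> alg_hom \<Sigma> (base K) (rel L)"
      "compose (elems (base K)) (leg0 L) s = f" "compose (elems (base K)) (leg1 L) s = g" by blast
    have "f x = leg0 L (s x)" "g x = leg1 L (s x)" using s(2,3) x by (auto simp: compose_def)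
    then show "(f x, g x) \<in> leg_rel L" unfolding leg_rel_def using alg_hom_in[OF s(1) x] by simp
  next
    assume "\<forall>x\<in>elems (base K). (f x, g x) \<in> leg_rel L"
    then show "\<exists>s\<in>alg_hom \<Sigma> (base K) (rel L). compose (elems (base K)) (leg0 L) s = f \<and>
      compose (elems (base K)) (leg1 L) s = g"
      using f g unfolding ex_arr_iff[OF K L]
      by (intro leg_rel_lift[OF P_V[OF pseudocongruence_base[OF L]] P_V[OF pseudocongruence_rel[OF L]]
        pseudocongruence_legs[OF L] pseudocongruence_base[OF K]]) blast+
  qed
  then show ?thesis unfolding ex_pre_def by (simp del: full_sub_simps(1)) blast
qed

lemma ex_arr_in: "\<lbrakk>pseudocongruence \<P> K; pseudocongruence \<P> L; f \<in> ex_arr \<P> K L; x \<in> elems (base K)\<rbrakk>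
    \<Longrightarrow> f x \<in> elems (base L)"
  by (rule alg_hom_in[of f \<Sigma> "base K"]) (simp_all add: ex_arr_iff)

text \<open>Equivalence of arrows becomes equality after the quotient map, which makes the
  equivalence relation laws immediate.\<close>

lemma ex_eq_iff:
  assumes K: "pseudocongruence \<P> K" and L: "pseudocongruence \<P> L"
  shows "(f, g) \<in> ex_eq \<P> K L \<longleftrightarrow> f \<in> ex_arr \<P> K L \<and> g \<in> ex_arr \<P> K L \<and>
    (\<forall>x\<in>elems (base K). quot_map L (f x) = quot_map L (g x))"
proof -
  have "(f, g) \<in> ex_eq \<P> K L \<longleftrightarrow> f \<in> ex_arr \<P> K L \<and> g \<in> ex_arr \<P> K L \<and>
    (\<forall>x\<in>elems (base K). (f x, g x) \<in> leg_rel L \<and> (g x, f x) \<in> leg_rel L)"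
    unfolding ex_eq_def Int_iff converse_iff ex_pre_iff[OF K L] by blast
  then show ?thesis
    using quot_map_eq_iff[OF L] ex_arr_in[OF K L] by (metis (no_types, lifting))
qed

lemma equiv_ex_eq:
  assumes K: "pseudocongruence \<P> K" and L: "pseudocongruence \<P> L"
  shows "equiv (ex_arr \<P> K L) (ex_eq \<P> K L)"
proof (rule equivI)
  show "ex_eq \<P> K L \<subseteq> ex_arr \<P> K L \<times> ex_arr \<P> K L" using ex_eq_iff[OF K L] by auto
  show "refl_on (ex_arr \<P> K L) (ex_eq \<P> K L)" by (simp add: refl_on_def ex_eq_iff[OF K L])
  show "sym (ex_eq \<P> K L)" by (auto simp: sym_def ex_eq_iff[OF K L])
  show "trans (ex_eq \<P> K L)" by (auto simp: trans_def ex_eq_iff[OF K L])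
qed

section \<open>Induced homomorphisms between the quotients\<close>

text \<open>Demanding the equation for all members of the class avoids a choice of
  representative.\<close>

definition quot_arr :: "(('f, 'u) alg, 'u \<Rightarrow> 'u) ppair \<Rightarrow> (('f, 'u) alg, 'u \<Rightarrow> 'u) ppair \<Rightarrow>
    ('u \<Rightarrow> 'u) set \<Rightarrow> 'u \<Rightarrow> 'u" where
  "quot_arr K L F = (THE h. h \<in> alg_hom \<Sigma> (quot \<Sigma> K) (quot \<Sigma> L) \<and>
     (\<forall>f\<in>F. \<forall>x\<in>elems (base K). h (quot_map K x) = quot_map L (f x)))"

lemma quot_arr:
  assumes K: "pseudocongruence \<P> K" and L: "pseudocongruence \<P> L" and f: "f \<in> ex_arr \<P> K L"
  shows "quot_arr K L (ex_class \<P> K L f) \<in> alg_hom \<Sigma> (quot \<Sigma> K) (quot \<Sigma> L)"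
    and "x \<in> elems (base K) \<Longrightarrow> quot_arr K L (ex_class \<P> K L f) (quot_map K x) = quot_map L (f x)"
proof -
  let ?Q = "\<lambda>h. h \<in> alg_hom \<Sigma> (quot \<Sigma> K) (quot \<Sigma> L) \<and>
     (\<forall>g\<in>ex_class \<P> K L f. \<forall>x\<in>elems (base K). h (quot_map K x) = quot_map L (g x))"
  have f': "f \<in> ex_class \<P> K L f" using equiv_class_self[OF equiv_ex_eq[OF K L] f] .
  have "is_hom \<Sigma> (preordered_base K) (preordered_base L) f"
    using f unfolding ex_arr_iff[OF K L] alg_hom_iff is_hom_def preordered_base_simps by blast
  from is_hom_comp[OF this quot_hom[OF L]]
  obtain h where h: "h \<in> alg_hom \<Sigma> (quot \<Sigma> K) (quot \<Sigma> L)"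
    "\<And>x. x \<in> elems (preordered_base K) \<Longrightarrow> h (quot_map K x) = (quot_map L \<circ> f) x"
    using collapse_factor[OF preordered_algebra_base[OF K] quot_map(1)[OF K] _ antisym_ord[OF quot_in_variety[OF L]]]
    unfolding quot_def[of _ K] by blast
  have "?Q h" using h by (simp add: ex_eq_iff[OF K L])
  \<comment> \<open>Uniqueness uses that the class is nonempty, since \<open>f\<close> belongs to
    it, and that the quotient map is onto.\<close>
  moreover have "k = h" if "?Q k" for k
    by (rule quot_hom_eqI[OF conjunct1[OF that] h(1)]) (use that f' h(2) in auto)
  ultimately have "?Q (quot_arr K L (ex_class \<P> K L f))" unfolding quot_arr_def by (rule theI)
  then show "quot_arr K L (ex_class \<P> K L f) \<in> alg_hom \<Sigma> (quot \<Sigma> K) (quot \<Sigma> L)"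
    and "x \<in> elems (base K) \<Longrightarrow> quot_arr K L (ex_class \<P> K L f) (quot_map K x) = quot_map L (f x)"
    using f' by blast+
qed

text \<open>Precomposing \<open>h\<close> with the quotient map of \<open>K\<close> gives a
  homomorphism from a free algebra, which lifts along the surjection onto the quotient of
  \<open>L\<close>.\<close>

lemma quot_arr_full:
  assumes K: "pseudocongruence \<P> K" and L: "pseudocongruence \<P> L"
    and h: "h \<in> alg_hom \<Sigma> (quot \<Sigma> K) (quot \<Sigma> L)"
  obtains f where "f \<in> ex_arr \<P> K L" "quot_arr K L (ex_class \<P> K L f) = h"
proof -
  note X = pseudocongruence_base[OF K] and Y = P_V[OF pseudocongruence_base[OF L]]
    and QL = quot_in_variety[OF L]
  have base_hom: "is_hom \<Sigma> (base M) (quot \<Sigma> M) (quot_map M)" if "pseudocongruence \<P> M" for M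
    using quot_hom[OF that] leg_rel_reflexive[OF that] unfolding is_hom_def by auto
  define q where "q = restrict (quot_map L) (elems (base L))"
  define k where "k = restrict (h \<circ> quot_map K) (elems (base K))"
  have q: "q \<in> alg_hom \<Sigma> (base L) (quot \<Sigma> L)"
    unfolding q_def by (intro alg_hom_restrict preordered[OF Y] base_hom[OF L])
  have k: "k \<in> alg_hom \<Sigma> (base K) (quot \<Sigma> L)"
    unfolding k_def
    by (intro alg_hom_restrict preordered[OF P_V[OF X]] is_hom_comp[OF base_hom[OF K]])
      (use h in \<open>simp add: alg_hom_iff\<close>)
  \<comment> \<open>Lifting along a single map is the case of \<open>lift_pair\<close> with both
    components equal.\<close>
  have "\<exists>w\<in>elems (base L). q w = k x \<and> q w = k x" if "x \<in> elems (base K)" for x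
    using alg_hom_in[OF k that] unfolding elems_quot q_def by auto
  then obtain f where f: "f \<in> alg_hom \<Sigma> (base K) (base L)" "compose (elems (base K)) q f = k"
    by (rule lift_pair[OF X Y QL QL q q k k])
  have f_q: "quot_map L (f x) = h (quot_map K x)" if "x \<in> elems (base K)" for x
    using fun_cong[OF f(2), of x] that alg_hom_in[OF f(1) that]
      by (simp add: compose_def q_def k_def)
  \<comment> \<open>Any such lift is an arrow of \<open>P_ex\<close>: \<open>h\<close> is monotone,
    and the order of the quotient of \<open>L\<close> restricts exactly to
    \<open>leg_rel L\<close>.\<close>
  have "(f x, f y) \<in> leg_rel L" if "(x, y) \<in> leg_rel K" for x y
  proof -
    have xy: "x \<in> elems (base K)" "y \<in> elems (base K)"
      using preordered_algebra_dom[OF preordered_algebra_base[OF K]] that by auto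
    have "(h (quot_map K x), h (quot_map K y)) \<in> ord (quot \<Sigma> L)"
      by (rule alg_hom_mono[OF h]) (use that ord_quot_iff[OF K xy] in simp)
    then show ?thesis
      unfolding f_q[OF xy(1), symmetric] f_q[OF xy(2), symmetric]
      using ord_quot_iff[OF L] alg_hom_in[OF f(1)] xy by blast
  qed
  then have f_arr: "f \<in> ex_arr \<P> K L" using f(1) by (simp add: ex_arr_iff[OF K L])
  moreover have "quot_arr K L (ex_class \<P> K L f) = h"
    by (rule quot_hom_eqI[OF quot_arr(1)[OF K L f_arr] h]) (simp add: quot_arr(2)[OF K L f_arr] f_q)
  ultimately show thesis by (rule that)
qed

lemma quot_arr_le_iff:
  assumes K: "pseudocongruence \<P> K" and L: "pseudocongruence \<P> L"
    and f: "f \<in> ex_arr \<P> K L" and g: "g \<in> ex_arr \<P> K L"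
  shows "(quot_arr K L (ex_class \<P> K L f), quot_arr K L (ex_class \<P> K L g)) \<in> hle \<V> (quot \<Sigma> K) (quot \<Sigma> L)
    \<longleftrightarrow> (f, g) \<in> ex_pre \<P> K L"
proof -
  have "(quot_arr K L (ex_class \<P> K L f), quot_arr K L (ex_class \<P> K L g)) \<in> hle \<V> (quot \<Sigma> K) (quot \<Sigma> L)
    \<longleftrightarrow> (\<forall>x\<in>elems (base K). (quot_map L (f x), quot_map L (g x)) \<in> ord (quot \<Sigma> L))"
    using quot_arr(1)[OF K L f] quot_arr(1)[OF K L g]
    by (simp add: pointwise_def elems_quot quot_arr(2)[OF K L f] quot_arr(2)[OF K L g])
  also have "\<dots> \<longleftrightarrow> (f, g) \<in> ex_pre \<P> K L"
    using ord_quot_iff[OF L] ex_arr_in[OF K L] f g by (simp add: ex_pre_iff[OF K L])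
  finally show ?thesis .
qed

lemma ex_arr_comp:
  assumes K: "pseudocongruence \<P> K" and L: "pseudocongruence \<P> L" and M: "pseudocongruence \<P> M"
    and f: "f \<in> ex_arr \<P> K L" and g: "g \<in> ex_arr \<P> L M"
  shows "compose (elems (base K)) g f \<in> ex_arr \<P> K M"
  unfolding ex_arr_iff[OF K M]
proof (intro conjI allI impI)
  show "compose (elems (base K)) g f \<in> alg_hom \<Sigma> (base K) (base M)"
    using f g unfolding ex_arr_iff[OF K L] ex_arr_iff[OF L M]
    by (intro alg_hom_compose[OF preordered[OF P_V[OF pseudocongruence_base[OF K]]]]) blast+
  fix x y assume xy: "(x, y) \<in> leg_rel K"
  then have "x \<in> elems (base K)" "y \<in> elems (base K)"
    using preordered_algebra_dom[OF preordered_algebra_base[OF K]] by auto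
  with xy f g show "(compose (elems (base K)) g f x, compose (elems (base K)) g f y) \<in> leg_rel M"
    unfolding ex_arr_iff[OF K L] ex_arr_iff[OF L M] by (simp add: compose_def)
qed

lemma ex_cmp_class:
  assumes K: "pseudocongruence \<P> K" and L: "pseudocongruence \<P> L" and M: "pseudocongruence \<P> M"
    and f: "f \<in> ex_arr \<P> K L" and g: "g \<in> ex_arr \<P> L M"
  shows "cmp (ex_cat \<P>) K L M (ex_class \<P> L M g) (ex_class \<P> K L f) =
    ex_class \<P> K M (compose (elems (base K)) g f)"
proof -
  have "ex_class \<P> K M (compose (elems (base K)) g' f') = ex_class \<P> K M (compose (elems (base K)) g f)"
    if f': "f' \<in> ex_class \<P> K L f" and g': "g' \<in> ex_class \<P> L M g" for f' g'
  proof (rule equiv_class_eq[OF equiv_ex_eq[OF K M]])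
    have f'_arr: "f' \<in> ex_arr \<P> K L"
      and f'_eq: "\<And>x. x \<in> elems (base K) \<Longrightarrow> quot_map L (f x) = quot_map L (f' x)"
      using f' by (simp_all add: ex_eq_iff[OF K L])
    have g'_arr: "g' \<in> ex_arr \<P> L M"
      and g'_eq: "\<And>x. x \<in> elems (base L) \<Longrightarrow> quot_map M (g x) = quot_map M (g' x)"
      using g' by (simp_all add: ex_eq_iff[OF L M])
    have "quot_map M (g' (f' x)) = quot_map M (g (f x))" if x: "x \<in> elems (base K)" for x
    proof -
      have "quot_map M (g' (f' x)) = quot_map M (g (f' x))"
        using g'_eq ex_arr_in[OF K L f'_arr x] by simp
      \<comment> \<open>Since \<open>g\<close> acts on the quotient of \<open>L\<close>, replacing
        \<open>f' x\<close> by the equivalent \<open>f x\<close> does not change the result.\<close>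
      also have "\<dots> = quot_arr L M (ex_class \<P> L M g) (quot_map L (f' x))"
        using quot_arr(2)[OF L M g] ex_arr_in[OF K L f'_arr x] by simp
      also have "\<dots> = quot_map M (g (f x))"
        unfolding f'_eq[OF x, symmetric] by (rule quot_arr(2)[OF L M g ex_arr_in[OF K L f x]])
      finally show ?thesis .
    qed
    then show "(compose (elems (base K)) g' f', compose (elems (base K)) g f) \<in> ex_eq \<P> K M"
      unfolding ex_eq_iff[OF K M]
      using ex_arr_comp[OF K L M f g] ex_arr_comp[OF K L M f'_arr g'_arr] by (simp add: compose_def)
  qed
  moreover have "f \<in> ex_class \<P> K L f" "g \<in> ex_class \<P> L M g"
    using equiv_class_self[OF equiv_ex_eq[OF K L] f] equiv_class_self[OF equiv_ex_eq[OF L M] g] by simp_all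
  ultimately show ?thesis unfolding ex_cat_simps full_sub_simps(4) variety_simps by blast
qed

lemma ex_idn:
  assumes K: "pseudocongruence \<P> K"
  shows "restrict (\<lambda>x. x) (elems (base K)) \<in> ex_arr \<P> K K"
  unfolding ex_arr_iff[OF K K]
  using alg_hom_idn[OF P_V[OF pseudocongruence_base[OF K]]]
    preordered_algebra_dom[OF preordered_algebra_base[OF K]] by auto

lemma ex_hom_cases:
  assumes "F \<in> hom (ex_cat \<P>) K L"
  obtains f where "f \<in> ex_arr \<P> K L" "F = ex_class \<P> K L f"
  using assms unfolding ex_cat_simps by (rule quotientE)

lemma ex_class_hom: "f \<in> ex_arr \<P> K L \<Longrightarrow> ex_class \<P> K L f \<in> hom (ex_cat \<P>) K L"
  unfolding ex_cat_simps by (rule quotientI)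

text \<open>Injectivity on homs is the description of \<open>ex_eq\<close> through the quotient map,
  and surjectivity is \<open>quot_arr_full\<close>. Identities and composites are compared on
  elements of the base, which cover the quotient.\<close>

lemma quot_functor: "order_ff_functor (ex_cat \<P>) \<V> (quot \<Sigma>) quot_arr"
proof
  show "pos_category \<V>" by (rule pos_category_variety)
next
  fix K assume "K \<in> obj (ex_cat \<P>)"
  then have K: "pseudocongruence \<P> K" by (simp add: ex_cat_simps)
  show "quot \<Sigma> K \<in> obj \<V>" by (rule quot_in_variety[OF K])
  show "idn (ex_cat \<P>) K \<in> hom (ex_cat \<P>) K K"
    using ex_class_hom[OF ex_idn[OF K]] unfolding ex_cat_simps(5) full_sub_simps variety_simps .
  show "quot_arr K K (idn (ex_cat \<P>) K) = idn \<V> (quot \<Sigma> K)"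
    unfolding ex_cat_simps(5) full_sub_simps variety_simps
    by (rule quot_hom_eqI[OF quot_arr(1)[OF K K ex_idn[OF K]] alg_hom_idn[OF quot_in_variety[OF K]]])
      (simp add: quot_arr(2)[OF K K ex_idn[OF K]] elems_quot)
next
  fix K L assume "K \<in> obj (ex_cat \<P>)" "L \<in> obj (ex_cat \<P>)"
  then have K: "pseudocongruence \<P> K" and L: "pseudocongruence \<P> L" by (simp_all add: ex_cat_simps)
  show "bij_betw (quot_arr K L) (hom (ex_cat \<P>) K L) (hom \<V> (quot \<Sigma> K) (quot \<Sigma> L))"
    unfolding bij_betw_def
  proof (intro conjI subset_antisym subsetI)
    show "inj_on (quot_arr K L) (hom (ex_cat \<P>) K L)"
    proof (rule inj_onI)
      fix F G assume "F \<in> hom (ex_cat \<P>) K L" "G \<in> hom (ex_cat \<P>) K L"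
        and eq: "quot_arr K L F = quot_arr K L G"
      then obtain f g where f: "f \<in> ex_arr \<P> K L" "F = ex_class \<P> K L f"
        and g: "g \<in> ex_arr \<P> K L" "G = ex_class \<P> K L g" by (metis ex_hom_cases)
      have "(f, g) \<in> ex_eq \<P> K L"
        unfolding ex_eq_iff[OF K L]
        using f(1) g(1) quot_arr(2)[OF K L f(1)] quot_arr(2)[OF K L g(1)] eq f(2) g(2) by simp
      then show "F = G" unfolding f(2) g(2) by (rule equiv_class_eq[OF equiv_ex_eq[OF K L]])
    qed
    fix h
    {
      assume "h \<in> quot_arr K L ` hom (ex_cat \<P>) K L"
      then obtain F where h: "h = quot_arr K L F" and "F \<in> hom (ex_cat \<P>) K L" by (rule imageE)
      from this(2) obtain f where "f \<in> ex_arr \<P> K L" "F = ex_class \<P> K L f" by (rule ex_hom_cases)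
      then show "h \<in> hom \<V> (quot \<Sigma> K) (quot \<Sigma> L)"
        unfolding h variety_simps using quot_arr(1)[OF K L] by simp
    next
      assume "h \<in> hom \<V> (quot \<Sigma> K) (quot \<Sigma> L)"
      then have "h \<in> alg_hom \<Sigma> (quot \<Sigma> K) (quot \<Sigma> L)" by simp
      then obtain f where f: "f \<in> ex_arr \<P> K L" "quot_arr K L (ex_class \<P> K L f) = h"
        by (rule quot_arr_full[OF K L])
      show "h \<in> quot_arr K L ` hom (ex_cat \<P>) K L"
        unfolding f(2)[symmetric] by (rule imageI[OF ex_class_hom[OF f(1)]])
    }
  qed
  fix F G
  show "(F, G) \<in> hle (ex_cat \<P>) K L \<longleftrightarrow> F \<in> hom (ex_cat \<P>) K L \<and> G \<in> hom (ex_cat \<P>) K L \<and>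
      (quot_arr K L F, quot_arr K L G) \<in> hle \<V> (quot \<Sigma> K) (quot \<Sigma> L)" (is "?l \<longleftrightarrow> ?r")
  proof
    assume ?l
    then obtain f g where fg: "F = ex_class \<P> K L f" "G = ex_class \<P> K L g" "(f, g) \<in> ex_pre \<P> K L"
      unfolding ex_cat_simps(3) by blast
    then have arr: "f \<in> ex_arr \<P> K L" "g \<in> ex_arr \<P> K L" by (simp_all add: ex_pre_iff[OF K L])
    show ?r using ex_class_hom[OF arr(1)] ex_class_hom[OF arr(2)] quot_arr_le_iff[OF K L arr] fg by blast
  next
    assume r: ?r
    obtain f where f: "f \<in> ex_arr \<P> K L" "F = ex_class \<P> K L f"
      using r by (blast elim: ex_hom_cases)
    obtain g where g: "g \<in> ex_arr \<P> K L" "G = ex_class \<P> K L g"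
      using r by (blast elim: ex_hom_cases)
    have "(f, g) \<in> ex_pre \<P> K L" using r quot_arr_le_iff[OF K L f(1) g(1)] f(2) g(2) by blast
    then show ?l unfolding ex_cat_simps(3) f(2) g(2) by blast
  qed
next
  fix K L M F G assume "K \<in> obj (ex_cat \<P>)" "L \<in> obj (ex_cat \<P>)" "M \<in> obj (ex_cat \<P>)"
    and F: "F \<in> hom (ex_cat \<P>) K L" and G: "G \<in> hom (ex_cat \<P>) L M"
  then have K: "pseudocongruence \<P> K" and L: "pseudocongruence \<P> L" and M: "pseudocongruence \<P> M"
    by (simp_all add: ex_cat_simps)
  obtain f where f: "f \<in> ex_arr \<P> K L" "F = ex_class \<P> K L f" using F by (rule ex_hom_cases)
  obtain g where g: "g \<in> ex_arr \<P> L M" "G = ex_class \<P> L M g" using G by (rule ex_hom_cases)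
  note gf = ex_arr_comp[OF K L M f(1) g(1)] and cmp = ex_cmp_class[OF K L M f(1) g(1)]
  show "cmp (ex_cat \<P>) K L M G F \<in> hom (ex_cat \<P>) K M"
    unfolding f(2) g(2) cmp by (rule ex_class_hom[OF gf])
  have QK: "preordered_algebra \<Sigma> (quot \<Sigma> K)" using preordered quot_in_variety[OF K] by blast
  show "quot_arr K M (cmp (ex_cat \<P>) K L M G F) =
      cmp \<V> (quot \<Sigma> K) (quot \<Sigma> L) (quot \<Sigma> M) (quot_arr L M G) (quot_arr K L F)"
    unfolding f(2) g(2) cmp variety_simps
  proof (rule quot_hom_eqI[OF quot_arr(1)[OF K M gf]
        alg_hom_compose[OF QK quot_arr(1)[OF K L f(1)] quot_arr(1)[OF L M g(1)]]])
    fix x assume x: "x \<in> elems (base K)"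
    then show "quot_arr K M (ex_class \<P> K M (compose (elems (base K)) g f)) (quot_map K x) =
      compose (elems (quot \<Sigma> K)) (quot_arr L M (ex_class \<P> L M g)) (quot_arr K L (ex_class \<P> K L f)) (quot_map K x)"
      using quot_arr(2)[OF K M gf x] quot_arr(2)[OF K L f(1) x]
        quot_arr(2)[OF L M g(1) ex_arr_in[OF K L f(1) x]]
      by (simp add: compose_def elems_quot)
  qed
qed

section \<open>Essential surjectivity\<close>

text \<open>A bijective homomorphism of ordered algebras need not be invertible. Order reflection
  supplies both injectivity, by antisymmetry, and monotonicity of the inverse.\<close>

lemma is_iso_variety:
  assumes A: "A \<in> obj \<V>" and B: "B \<in> obj \<V>" and h: "h \<in> alg_hom \<Sigma> A B"
    and surj: "h ` elems A = elems B"
    and le: "\<And>x y. \<lbrakk>x \<in> elems A; y \<in> elems A; (h x, h y) \<in> ord B\<rbrakk> \<Longrightarrow> (x, y) \<in> ord A"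
  shows "is_iso \<V> A B h"
proof -
  define k where "k = restrict (inv_into (elems A) h) (elems B)"
  have inj: "x = y" if "x \<in> elems A" "y \<in> elems A" "h x = h y" for x y
    using le[OF that(1,2)] le[OF that(2,1)] that antisymD[OF antisym_ord[OF A]] alg_hom_in[OF h]
      preordered_algebra_refl[OF preordered[OF B]] by metis
  have kh: "k (h x) = x" if "x \<in> elems A" for x
  proof -
    have "inv_into (elems A) h (h x) = x"
      using that inj by (intro inv_into_f_f inj_onI)
    then show ?thesis using alg_hom_in[OF h that] by (simp add: k_def)
  qed
  have k_in: "k y \<in> elems A" and hk: "h (k y) = y" if "y \<in> elems B" for y
  proof -
    have "y \<in> h ` elems A" using that surj by simp
    then show "k y \<in> elems A" "h (k y) = y"
      using that by (simp_all add: k_def inv_into_into f_inv_into_f)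
  qed
  have "is_hom \<Sigma> B A k"
    unfolding is_hom_def
  proof (intro conjI ballI allI impI)
    show "k ` elems B \<subseteq> elems A" using k_in by blast
    show "case z of (x, y) \<Rightarrow> (k x, k y) \<in> ord A" if "z \<in> ord B" for z
    proof -
      obtain x y where z: "z = (x, y)" by (cases z)
      have "x \<in> elems B" "y \<in> elems B"
        using that preordered_algebra_dom[OF preordered[OF B]] unfolding z by blast+
      then show ?thesis using that k_in hk le unfolding z by simp
    qed
    fix f xs assume f: "f \<in> syms \<Sigma>" "set xs \<subseteq> elems B" "length xs = arity \<Sigma> f"
    have "map h (map k xs) = xs" using f(2) hk by (simp add: map_idI subset_iff)
    moreover have kxs: "set (map k xs) \<subseteq> elems A" using f(2) k_in by auto
    ultimately have "h (opn A f (map k xs)) = opn B f xs"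
      using alg_hom_opn[OF h f(1) kxs] f(3) by simp
    moreover have "opn A f (map k xs) \<in> elems A"
      using preordered_algebra_opn[OF preordered[OF A] f(1) kxs] f(3) by simp
    ultimately show "k (opn B f xs) = opn A f (map k xs)" using kh by metis
  qed
  then have "k \<in> alg_hom \<Sigma> B A" by (simp add: alg_hom_iff k_def)
  moreover have "compose (elems A) k h = restrict (\<lambda>x. x) (elems A)"
    "compose (elems B) h k = restrict (\<lambda>x. x) (elems B)"
    using kh hk by (auto simp: compose_def)
  ultimately show ?thesis unfolding is_iso_def variety_simps using h by blast
qed

lemma quot_ess_surj:
  assumes B: "B \<in> obj \<V>"
  shows "\<exists>K\<in>obj (ex_cat \<P>). \<exists>f. is_iso \<V> (quot \<Sigma> K) B f"
proof -
  obtain X and \<eta> :: "'u \<Rightarrow> 'u" where X: "X \<in> obj \<P>" and \<eta>: "basis X (elems B) \<eta>"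
    using small_elems[OF B] by (rule exists_free)
  obtain e where e: "e \<in> alg_hom \<Sigma> X B" "\<And>b. b \<in> elems B \<Longrightarrow> e (\<eta> b) = b"
    by (rule basis_extend[OF \<eta> B, of "\<lambda>b. b"]) auto
  define D where "D = {(x, y). x \<in> elems X \<and> y \<in> elems X \<and> (e x, e y) \<in> ord B}"
  have "small U (elems X \<times> elems X)"
    using small_Times[OF universe] small_elems[OF P_V[OF X]] by blast
  then have "small U D" by (rule small_subset) (auto simp: D_def)
  then obtain R and \<rho> :: "'u \<times> 'u \<Rightarrow> 'u" where R: "R \<in> obj \<P>" and \<rho>: "basis R D \<rho>"
    by (rule exists_free)
  obtain r0 where r0: "r0 \<in> alg_hom \<Sigma> R X" "\<And>p. p \<in> D \<Longrightarrow> r0 (\<rho> p) = fst p"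
    by (rule basis_extend[OF \<rho> P_V[OF X], of fst]) (auto simp: D_def)
  obtain r1 where r1: "r1 \<in> alg_hom \<Sigma> R X" "\<And>p. p \<in> D \<Longrightarrow> r1 (\<rho> p) = snd p"
    by (rule basis_extend[OF \<rho> P_V[OF X], of snd]) (auto simp: D_def)
  define K where "K = \<lparr>base = X, rel = R, leg0 = r0, leg1 = r1\<rparr>"
  have K_simps [simp]: "base K = X" "rel K = R" "leg0 K = r0" "leg1 K = r1" by (simp_all add: K_def)
  note comp = alg_hom_compose[OF preordered[OF P_V[OF R]]]
  \<comment> \<open>The inequality holds at the generators of \<open>R\<close> by the choice of
    \<open>D\<close>, and the order clause of \<open>basis\<close> spreads it over \<open>R\<close>.
    Hence the legs produce no pairs outside \<open>D\<close>.\<close>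
  have le: "(e (r0 z), e (r1 z)) \<in> ord B" if z: "z \<in> elems R" for z
  proof -
    have "(compose (elems R) e r0 z, compose (elems R) e r1 z) \<in> ord B"
    proof (rule basis_le[OF \<rho> B comp[OF r0(1) e(1)] comp[OF r1(1) e(1)] _ z])
      fix p assume "p \<in> D"
      then show "(compose (elems R) e r0 (\<rho> p), compose (elems R) e r1 (\<rho> p)) \<in> ord B"
        using r0(2) r1(2) basis_in[OF \<rho>] by (auto simp: compose_def D_def)
    qed
    then show ?thesis using z by (simp add: compose_def)
  qed
  have leg_rel: "leg_rel K = D"
  proof (rule subset_antisym)
    show "leg_rel K \<subseteq> D"
      using le alg_hom_in[OF r0(1)] alg_hom_in[OF r1(1)] by (auto simp: leg_rel_def D_def)
    show "D \<subseteq> leg_rel K"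
    proof
      fix p assume p: "p \<in> D"
      then show "p \<in> leg_rel K"
        unfolding leg_rel_def using r0(2) r1(2) basis_in[OF \<rho> p]
        by (intro image_eqI[of _ _ "\<rho> p"]) simp_all
    qed
  qed
  \<comment> \<open>\<open>D\<close> is the preimage of the order of \<open>B\<close> under the
    monotone map \<open>e\<close>, so it contains the order of \<open>X\<close> and is
    transitive.\<close>
  have K: "pseudocongruence \<P> K"
  proof (rule pseudocongruenceI)
    show "ord (base K) \<subseteq> leg_rel K"
      unfolding leg_rel D_def
      using preordered_algebra_dom[OF preordered[OF P_V[OF X]]] alg_hom_mono[OF e(1)] by auto
    show "trans (leg_rel K)"
      unfolding leg_rel D_def trans_def using preordered_algebra_trans[OF preordered[OF B]] by blast
  qed (use X R r0(1) r1(1) in simp_all)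
  have leg_iff: "(x, y) \<in> leg_rel K \<longleftrightarrow> (e x, e y) \<in> ord B" if "x \<in> elems X" "y \<in> elems X" for x y
    using that by (simp add: leg_rel D_def)
  \<comment> \<open>\<open>e\<close> stays monotone for the enlarged order \<open>D\<close> and so
    factors through the quotient. The factor is onto because \<open>e\<close> is, and it reflects
    the order because \<open>D\<close> is the full preimage.\<close>
  have "is_hom \<Sigma> (preordered_base K) B e"
    using e(1) unfolding alg_hom_iff is_hom_def preordered_base_simps K_simps
      by (auto simp: leg_rel D_def)
  then obtain h where h: "h \<in> alg_hom \<Sigma> (quot \<Sigma> K) B" "\<And>x. x \<in> elems X \<Longrightarrow> h (quot_map K x) = e x"
    using collapse_factor[OF preordered_algebra_base[OF K] quot_map(1)[OF K] _ antisym_ord[OF B]]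
    unfolding quot_def by (metis preordered_base_simps(1) K_simps(1))
  have "is_iso \<V> (quot \<Sigma> K) B h"
  proof (rule is_iso_variety[OF quot_in_variety[OF K] B h(1)])
    have "b \<in> h ` elems (quot \<Sigma> K)" if "b \<in> elems B" for b
      unfolding elems_quot image_image K_simps
      using basis_in[OF \<eta> that] h(2) e(2)[OF that] by (intro image_eqI[of _ _ "\<eta> b"]) simp_all
    then show "h ` elems (quot \<Sigma> K) = elems B" using alg_hom_in[OF h(1)] by blast
    fix u v assume "u \<in> elems (quot \<Sigma> K)" "v \<in> elems (quot \<Sigma> K)" and huv: "(h u, h v) \<in> ord B"
    then obtain x y where xy: "u = quot_map K x" "v = quot_map K y" "x \<in> elems X" "y \<in> elems X"
      by (auto simp: elems_quot)
    then show "(u, v) \<in> ord (quot \<Sigma> K)"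
      using ord_quot_iff[OF K, of x y] leg_iff[OF xy(3,4)] huv h(2) by simp
  qed
  moreover have "K \<in> obj (ex_cat \<P>)" using K by (simp add: ex_cat_simps)
  ultimately show ?thesis by blast
qed

lemma pos_equivalent_ex_cat: "pos_equivalent \<V> (ex_cat \<P>)"
  using order_ff_functor.pos_equivalent_source[OF quot_functor] quot_ess_surj by blast

end

theorem corollary5p3:
  fixes U :: "'u set set"
    and \<Sigma> :: "'f signature"
    and E :: "(('f, 'v) tm \<times> ('f, 'v) tm) set"
    and \<V> \<P> :: "(('f, 'u) alg, 'u \<Rightarrow> 'u) pcat"
  assumes universe: "size_universe U"
    and small_signature: "\<exists>S\<in>U. syms \<Sigma> \<lesssim> S"
    and wf_inequations: "\<forall>(s, t)\<in>E. wf_tm \<Sigma> s \<and> wf_tm \<Sigma> t"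
  defines "\<V> \<equiv> variety U \<Sigma> E"
    and "\<P> \<equiv> full_sub \<V> (free_on_discrete U \<V>)"
  shows "pos_equivalent \<V> (ex_cat \<P>)"
proof -
  interpret ordered_variety U \<Sigma> E
    using universe small_signature wf_inequations by unfold_locales (simp_all add: small_def)
  show ?thesis unfolding \<V>_def \<P>_def by (rule pos_equivalent_ex_cat)
qed

end
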